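(* Let $N\ge 3$, $0<\lambda\le\Lambda$, $a>-1$, and let $\mathcal{M}^{\pm}$ denote one of the two Pucci extremal operators $\mathcal{M}^+_{\lambda,\Lambda}$, $\mathcal{M}^-_{\lambda,\Lambda}$; in the case of $\mathcal{M}^+_{\lambda,\Lambda}$ assume in addition $\tilde N_+=\frac{\lambda}{\Lambda}(N-1)+1>2$. Then for any $p>1$ and any $0<\mathfrak a<\mathfrak b<+\infty$, setting $\Omega=\{x\in\mathbb{R}^N:\ \mathfrak a<|x|<\mathfrak b\}$, the problem $$\mathcal{M}^{\pm}(D^2u)+|x|^a u^p=0 \ \text{ in }\Omega,\qquad u>0\ \text{ in }\Omega,\qquad u=0\ \text{ on }\partial\Omega$$ has a positive radial (classical) solution.
   Context: For a symmetric $N\times N$ matrix $X$ with eigenvalues $e_1,\dots,e_N$, $\mathcal{M}^+_{\lambda,\Lambda}(X)=\Lambda\sum_{e_i\ge0}e_i+\lambda\sum_{e_i<0}e_i$ and $\mathcal{M}^-_{\lambda,\Lambda}(X)=\lambda\sum_{e_i\ge0}e_i+\Lambda\sum_{e_i<0}e_i$. Solutions are classical: $u$ is $C^2$ in $\Omega$ and continuous up to the boundary, where the Dirichlet condition holds. *)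

theory Defs
  imports "HOL-Analysis.Analysis" "HOL-Computational_Algebra.Polynomial"
begin

definition charpoly :: "real^'n^'n \<Rightarrow> real poly" where
  "charpoly X = det (\<chi> i j. (if i = j then [:0, 1:] else 0) - [:X $ i $ j:])"

(* The real roots of the characteristic polynomial, repeated according to their algebraic
   multiplicity.  For symmetric X these are all the eigenvalues e_1, ..., e_N; for other
   matrices the multiset may have fewer than N elements. *)
definition eigenvalues :: "real^'n^'n \<Rightarrow> real multiset" where
  "eigenvalues X = proots (charpoly X)"

definition pucci_plus :: "real \<Rightarrow> real \<Rightarrow> real^'n^'n \<Rightarrow> real" where
  "pucci_plus lam Lam X =
     Lam * (\<Sum>e\<in>#{#e \<in># eigenvalues X. e \<ge> 0#}. e) + lam * (\<Sum>e\<in>#{#e \<in># eigenvalues X. e < 0#}. e)"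

definition pucci_minus :: "real \<Rightarrow> real \<Rightarrow> real^'n^'n \<Rightarrow> real" where
  "pucci_minus lam Lam X =
     lam * (\<Sum>e\<in>#{#e \<in># eigenvalues X. e \<ge> 0#}. e) + Lam * (\<Sum>e\<in>#{#e \<in># eigenvalues X. e < 0#}. e)"

definition partial_derivative :: "'n \<Rightarrow> (real^'n \<Rightarrow> real) \<Rightarrow> real^'n \<Rightarrow> real" where
  "partial_derivative i f x = frechet_derivative f (at x) (axis i 1)"

definition hessian :: "(real^'n \<Rightarrow> real) \<Rightarrow> real^'n \<Rightarrow> real^'n^'n" where
  "hessian f x = (\<chi> i j. partial_derivative i (partial_derivative j f) x)"

(* Meant for open S.  The derivatives are full (two-sided) ones at each point of S, so the
   values of f outside S play no role; continuity of f and of its first partial derivatives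
   follows from their differentiability. *)
definition C2_on :: "(real^'n) set \<Rightarrow> (real^'n \<Rightarrow> real) \<Rightarrow> bool" where
  "C2_on S f \<longleftrightarrow>
     (\<forall>x\<in>S. f differentiable (at x)) \<and>
     (\<forall>j. \<forall>x\<in>S. partial_derivative j f differentiable (at x)) \<and>
     (\<forall>i j. continuous_on S (partial_derivative i (partial_derivative j f)))"

definition annulus :: "real \<Rightarrow> real \<Rightarrow> (real^'n) set" where
  "annulus r R = {x. r < norm x \<and> norm x < R}"

definition radial_on :: "(real^'n) set \<Rightarrow> (real^'n \<Rightarrow> real) \<Rightarrow> bool" where
  "radial_on S u \<longleftrightarrow> (\<exists>v. \<forall>x\<in>S. u x = v (norm x))"

(* u is a total function, but only its values on the closure of \<Omega> matter. *)
definition classical_positive_solution ::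
  "(real^'n^'n \<Rightarrow> real) \<Rightarrow> real \<Rightarrow> real \<Rightarrow> (real^'n) set \<Rightarrow> (real^'n \<Rightarrow> real) \<Rightarrow> bool" where
  "classical_positive_solution M a p \<Omega> u \<longleftrightarrow>
     C2_on \<Omega> u \<and> continuous_on (closure \<Omega>) u \<and>
     (\<forall>x\<in>\<Omega>. M (hessian u x) + norm x powr a * u x powr p = 0) \<and>
     (\<forall>x\<in>\<Omega>. u x > 0) \<and>
     (\<forall>x\<in>frontier \<Omega>. u x = 0)"

end

theory Submission
  imports Defs
begin

text \<open>
  For a radial function \<open>u x = v (norm x)\<close> the Hessian at \<open>x\<close> has the simple eigenvalue \<open>v''\<close> and the
  eigenvalue \<open>v' / r\<close> of multiplicity \<open>N - 1\<close>.  With the piecewise linear function \<open>P s = A s\<close> for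
  \<open>s \<ge> 0\<close> and \<open>P s = B s\<close> for \<open>s < 0\<close>, both Pucci operators have the form
  \<open>P v'' + (N - 1) P (v' / r)\<close> with \<open>A\<close>, \<open>B\<close> positive, so the problem becomes the boundary value problem
  \<open>P v'' + (N - 1) / r * P v' + r\<^sup>a v\<^sup>p = 0\<close>, \<open>v (r0) = v (r1) = 0\<close>, \<open>v > 0\<close>.

  The equation is positively homogeneous of degree one except for the power: if \<open>v\<close> solves it with the
  forcing term \<open>\<mu> r\<^sup>a v\<^sup>p\<close>, then \<open>t v\<close> with \<open>t\<^sup>p = \<mu> t\<close> solves it with the forcing term \<open>r\<^sup>a v\<^sup>p\<close>.
  This turns the search for a shooting slope into the search for a forcing strength:
  start with \<open>v (r0) = 0\<close>, \<open>v' (r0) = 1\<close>, and look for \<open>\<mu> > 0\<close> such that the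
  trajectory vanishes at \<open>r1\<close>.  The end value \<open>v (r1)\<close> depends continuously on \<open>\<mu>\<close> (the Picard iteration is run in
  the space of functions of both \<open>\<mu>\<close> and \<open>r\<close>, lemma \<open>parametric_picard\<close>), so the intermediate value theorem
  gives such a \<open>\<mu>\<close> from the first two of the following facts.  The third one makes the solution positive.

  \<^item> Without forcing the trajectory increases, so \<open>v (r1) > 0\<close> (\<open>v_end_positive_if_unforced\<close>).
  \<^item> If \<open>v (r1) \<ge> 0\<close> then \<open>\<mu>\<close> is bounded by a constant that depends on the data only (\<open>strength_bound\<close>), so
    \<open>v (r1) < 0\<close> for large \<open>\<mu>\<close>.
  \<^item> A trajectory with \<open>v (r1) \<ge> 0\<close> is positive in between (\<open>v_positive\<close>): once it has stopped rising it never
    rises again, and once it has started to fall it falls strictly.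

  The bound on \<open>\<mu>\<close> comes from two estimates on a height \<open>U = v (q)\<close> at a suitable interior point \<open>q\<close>.
  Strong forcing bends the graph, and a graph that stays nonnegative
  up to \<open>r1\<close> cannot bend by more than a multiple of its height: \<open>\<mu> U\<^sup>p \<le> C\<^sub>1 U\<close>.  On the other
  hand the slope has to decrease from \<open>1\<close> to a multiple of \<open>U\<close> or to \<open>0\<close>, which needs \<open>1 \<le> C\<^sub>2 (U + \<mu> U\<^sup>p)\<close>.
  The first estimate makes \<open>U\<close> small when \<open>\<mu>\<close> is large, the second one keeps it away from \<open>0\<close>.
\<close>

section \<open>Eigenvalues of a scalar matrix plus a rank-one matrix\<close>

lemma poly_det:
  fixes A :: "real poly^'n^'n"
  shows "poly (det A) t = det (\<chi> i j. poly (A $ i $ j) t)"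
  unfolding det_def by (simp add: poly_sum poly_prod)

text \<open>
  An orthogonal matrix whose \<open>k\<close>-th column is \<open>x / norm x\<close> diagonalizes the matrix: the entry at \<open>k\<close> becomes
  \<open>c - d * (norm x)\<^sup>2\<close>, all other diagonal entries are \<open>c\<close>.
\<close>

lemma det_scalar_minus_rank_one:
  fixes x :: "real^'n"
  assumes "x \<noteq> 0"
  shows "det (\<chi> i j. (if i = j then c else 0) - d * x $ i * x $ j)
    = c ^ (CARD('n) - 1) * (c - d * (norm x)\<^sup>2)"
proof -
  obtain k :: 'n where "k \<in> UNIV" by blast
  obtain A :: "real^'n^'n" where A: "orthogonal_matrix A" "A *v axis k 1 = x /\<^sub>R norm x"
    using orthogonal_matrix_exists_basis[of "x /\<^sub>R norm x" k] assms by auto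
  have col: "A $ i $ k = x $ i / norm x" for i
    using arg_cong[OF A(2), of "\<lambda>v. v $ i"]
    by (simp add: matrix_vector_mult_basis column_def divide_inverse mult.commute)
  have orth: "(\<Sum>l\<in>UNIV. A $ i $ l * A $ j $ l) = (if i = j then 1 else 0)" for i j
  proof -
    have "A ** transpose A = mat 1"
      using A(1) by (simp add: orthogonal_matrix_def)
    then have "(A ** transpose A) $ i $ j = (mat 1 :: real^'n^'n) $ i $ j" by simp
    then show ?thesis by (simp add: matrix_matrix_mult_def transpose_def mat_def)
  qed
  define e where "e = (\<lambda>l. if l = k then c - d * (norm x)\<^sup>2 else c)"
  define E :: "real^'n^'n" where "E = (\<chi> i j. if i = j then e i else 0)"
  have "(A ** E ** transpose A) $ i $ j = (if i = j then c else 0) - d * x $ i * x $ j" for i j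
  proof -
    have "(A ** E ** transpose A) $ i $ j = (\<Sum>l\<in>UNIV. (\<Sum>m\<in>UNIV. A $ i $ m * E $ m $ l) * A $ j $ l)"
      by (simp add: matrix_matrix_mult_def transpose_def)
    also have "\<dots> = (\<Sum>l\<in>UNIV. A $ i $ l * e l * A $ j $ l)"
      by (simp add: E_def if_distrib[of "\<lambda>x. _ * x"] sum.delta cong: if_cong)
    also have "\<dots> = (\<Sum>l\<in>UNIV. c * (A $ i $ l * A $ j $ l)
        - (if l = k then d * (norm x)\<^sup>2 * (A $ i $ l * A $ j $ l) else 0))"
      by (intro sum.cong) (auto simp: e_def algebra_simps)
    also have "\<dots> = c * (\<Sum>l\<in>UNIV. A $ i $ l * A $ j $ l) - d * (norm x)\<^sup>2 * (A $ i $ k * A $ j $ k)"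
      by (simp add: sum_subtractf sum_distrib_left)
    also have "\<dots> = (if i = j then c else 0) - d * x $ i * x $ j"
      unfolding orth col using assms by (simp add: power2_eq_square)
    finally show ?thesis .
  qed
  then have eq: "(\<chi> i j. (if i = j then c else 0) - d * x $ i * x $ j) = A ** E ** transpose A"
    by (simp add: vec_eq_iff)
  have "det (A ** E ** transpose A) = det A * det A * det E"
    by (simp add: det_mul det_transpose)
  also have "det A * det A = 1"
    using det_orthogonal_matrix[OF A(1)] by auto
  also have "det E = (\<Prod>l\<in>UNIV. e l)"
    unfolding E_def by (subst det_diagonal) auto
  also have "\<dots> = e k * (\<Prod>l\<in>UNIV - {k}. e l)"
    by (rule prod.remove) auto
  also have "(\<Prod>l\<in>UNIV - {k}. e l) = (\<Prod>l\<in>UNIV - {k}. c)"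
    by (rule prod.cong) (auto simp: e_def)
  finally show ?thesis
    unfolding eq by (simp add: e_def card_Diff_singleton)
qed

text \<open>
  Two real polynomials with the same values are equal, so the characteristic polynomial can be read off from
  the determinant at every real argument.
\<close>

lemma eigenvalues_scalar_plus_rank_one:
  fixes x :: "real^'n"
  assumes "x \<noteq> 0"
  shows "eigenvalues (\<chi> i j. (if i = j then \<alpha> else 0) + \<beta> * x $ i * x $ j)
    = replicate_mset (CARD('n) - 1) \<alpha> + {#\<alpha> + \<beta> * (norm x)\<^sup>2#}"
proof -
  have "poly (charpoly (\<chi> i j. (if i = j then \<alpha> else 0) + \<beta> * x $ i * x $ j)) t
     = poly ([:-\<alpha>, 1:] ^ (CARD('n) - 1) * [:-(\<alpha> + \<beta> * (norm x)\<^sup>2), 1:]) t" for t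
  proof -
    have "poly (charpoly (\<chi> i j. (if i = j then \<alpha> else 0) + \<beta> * x $ i * x $ j)) t
       = det (\<chi> i j. (if i = j then t - \<alpha> else 0) - \<beta> * x $ i * x $ j)"
      unfolding charpoly_def poly_det
      by (rule arg_cong[where f=det]) (auto simp: vec_eq_iff)
    also have "\<dots> = (t - \<alpha>) ^ (CARD('n) - 1) * (t - \<alpha> - \<beta> * (norm x)\<^sup>2)"
      by (rule det_scalar_minus_rank_one[OF assms])
    finally show ?thesis
      by (simp add: algebra_simps)
  qed
  then have "charpoly (\<chi> i j. (if i = j then \<alpha> else 0) + \<beta> * x $ i * x $ j)
     = [:-\<alpha>, 1:] ^ (CARD('n) - 1) * [:-(\<alpha> + \<beta> * (norm x)\<^sup>2), 1:]"
    by (simp add: poly_eq_poly_eq_iff[symmetric] fun_eq_iff)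
  then have "eigenvalues (\<chi> i j. (if i = j then \<alpha> else 0) + \<beta> * x $ i * x $ j)
     = proots ([:-\<alpha>, 1:] ^ (CARD('n) - 1) * [:-(\<alpha> + \<beta> * (norm x)\<^sup>2), 1:])"
    by (simp only: eigenvalues_def)
  also have "\<dots> = proots ([:-\<alpha>, 1:] ^ (CARD('n) - 1)) + proots [:-(\<alpha> + \<beta> * (norm x)\<^sup>2), 1:]"
    by (rule proots_mult) auto
  finally show ?thesis
    by (simp only: proots_power proots_linear_factor) simp
qed

text \<open>
  The Pucci operator in dimension one: \<open>A = Lam\<close>, \<open>B = lam\<close> gives \<open>pucci_plus\<close>, and \<open>A = lam\<close>, \<open>B = Lam\<close>
  gives \<open>pucci_minus\<close>.  For positive \<open>A\<close>, \<open>B\<close> its inverse is \<open>pucci_real (1/A) (1/B)\<close>.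
\<close>

definition pucci_real :: "real \<Rightarrow> real \<Rightarrow> real \<Rightarrow> real" where
  "pucci_real A B s = (if s \<ge> 0 then A * s else B * s)"

text \<open>
  The form of the Pucci operators on the Hessian of a radial function, where \<open>\<alpha> = v' / r\<close> and
  \<open>\<alpha> + \<beta> * (norm x)\<^sup>2 = v''\<close>.
\<close>

lemma weighted_eigenvalue_sum:
  fixes x :: "real^'n" and \<alpha> \<beta> :: real
  assumes "x \<noteq> 0"
  defines "X \<equiv> (\<chi> i j. (if i = j then \<alpha> else 0) + \<beta> * x $ i * x $ j) :: real^'n^'n"
  shows "A * (\<Sum>e\<in>#{#e \<in># eigenvalues X. e \<ge> 0#}. e) + B * (\<Sum>e\<in>#{#e \<in># eigenvalues X. e < 0#}. e)
    = pucci_real A B (\<alpha> + \<beta> * (norm x)\<^sup>2) + (real CARD('n) - 1) * pucci_real A B \<alpha>"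
proof -
  have 1: "real CARD('n) - 1 = real (CARD('n) - 1)"
    by (simp add: of_nat_diff Suc_leI)
  have 2: "{#e \<in># replicate_mset n \<alpha>. P e#} = (if P \<alpha> then replicate_mset n \<alpha> else {#})" for n P
    by (induction n) auto
  have 3: "\<Sum>\<^sub># (replicate_mset n \<alpha>) = real n * \<alpha>" for n
    by (induction n) (auto simp: algebra_simps)
  show ?thesis
    unfolding X_def eigenvalues_scalar_plus_rank_one[OF assms(1)] 1 pucci_real_def
    by (auto simp: 2 3 algebra_simps)
qed

section \<open>Hessians of radial functions\<close>

lemma norm_has_derivative:
  fixes x :: "'a::real_inner"
  assumes "x \<noteq> 0"
  shows "(norm has_derivative (\<lambda>h. h \<bullet> x / norm x)) (at x)"
  using has_derivative_norm[OF assms]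
  by (simp add: sgn_div_norm inner_commute divide_inverse mult.commute)

lemma radial_has_derivative:
  fixes x :: "'a::real_inner"
  assumes "(w has_real_derivative D) (at (norm x))" "x \<noteq> 0"
  shows "((\<lambda>x. w (norm x)) has_derivative (\<lambda>h. D * (h \<bullet> x / norm x))) (at x)"
  using has_derivative_compose[OF norm_has_derivative[OF assms(2)]
      assms(1)[unfolded has_field_derivative_def]]
  by (simp add: mult.commute)

text \<open>
  The function \<open>w (norm x) * x $ j / norm x\<close> is the \<open>j\<close>-th partial derivative of \<open>v (norm x)\<close> for \<open>w = v'\<close>, so
  this derivative contains the \<open>j\<close>-th column of the Hessian.
\<close>

lemma radial_gradient_has_derivative:
  fixes x :: "real^'n"
  assumes w: "(w has_real_derivative z) (at (norm x))" and x: "x \<noteq> 0"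
  shows "((\<lambda>x. w (norm x) * x $ j / norm x) has_derivative
    (\<lambda>h. w (norm x) / norm x * h $ j
       + (z - w (norm x) / norm x) / (norm x)\<^sup>2 * (h \<bullet> x) * x $ j)) (at x)"
proof -
  have "((\<lambda>x. x $ j) has_derivative (\<lambda>h. h $ j)) (at x)"
    by (rule bounded_linear.has_derivative[OF bounded_linear_vec_nth has_derivative_ident])
  from has_derivative_divide[OF has_derivative_mult[OF radial_has_derivative[OF w x] this]
      norm_has_derivative[OF x]] x
  have "((\<lambda>x. w (norm x) * x $ j / norm x) has_derivative
      (\<lambda>h. - (w (norm x) * x $ j) * (inverse (norm x) * (h \<bullet> x / norm x) * inverse (norm x)) +
           (w (norm x) * h $ j + z * (h \<bullet> x / norm x) * x $ j) / norm x)) (at x)"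
    by simp
  then show ?thesis
    by (rule has_derivative_eq_rhs) (use x in \<open>auto simp: fun_eq_iff field_simps power2_eq_square\<close>)
qed

lemma partial_derivative_eqI:
  assumes "(f has_derivative f') (at x)"
  shows "partial_derivative i f x = f' (axis i 1)"
  by (simp add: partial_derivative_def flip: frechet_derivative_at[OF assms])

lemma open_annulus: "open (annulus r R)"
proof -
  have "annulus r R = norm -` {r<..<R}" by (auto simp: annulus_def)
  then show ?thesis by (metis open_greaterThanLessThan open_vimage continuous_on_norm_id)
qed

lemma
  fixes v y z :: "real \<Rightarrow> real"
  assumes "0 < r"
    and v: "\<And>s. r < s \<Longrightarrow> s < R \<Longrightarrow> (v has_real_derivative y s) (at s)"
    and y: "\<And>s. r < s \<Longrightarrow> s < R \<Longrightarrow> (y has_real_derivative z s) (at s)"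
    and z: "continuous_on {r<..<R} z"
  defines "u \<equiv> (\<lambda>x :: real^'n. v (norm x))"
  shows C2_on_radial: "C2_on (annulus r R) u"
    and hessian_radial: "x \<in> annulus r R \<Longrightarrow> hessian u x =
      (\<chi> i j. (if i = j then y (norm x) / norm x else 0)
        + (z (norm x) - y (norm x) / norm x) / (norm x)\<^sup>2 * x $ i * x $ j)"
proof -
  let ?S = "annulus r R :: (real^'n) set"
  let ?H = "\<lambda>i j x. (if i = j then y (norm x) / norm x else 0)
        + (z (norm x) - y (norm x) / norm x) / (norm x)\<^sup>2 * x $ i * x $ j"
  have nz: "x \<noteq> 0" "r < norm x" "norm x < R" if "x \<in> ?S" for x
    using that \<open>0 < r\<close> by (auto simp: annulus_def)
  have du: "(u has_derivative (\<lambda>h. y (norm x) * (h \<bullet> x / norm x))) (at x)" if "x \<in> ?S" for x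
    unfolding u_def using radial_has_derivative[OF v] nz[OF that] by blast
  have pu: "partial_derivative j u x = y (norm x) * x $ j / norm x" if "x \<in> ?S" for x j
    by (subst partial_derivative_eqI[OF du[OF that]]) (simp add: inner_axis')
  have dpu: "(partial_derivative j u has_derivative (\<lambda>h. y (norm x) / norm x * h $ j
       + (z (norm x) - y (norm x) / norm x) / (norm x)\<^sup>2 * (h \<bullet> x) * x $ j)) (at x)"
    if "x \<in> ?S" for x j
    by (rule has_derivative_transform_within_open[OF
          radial_gradient_has_derivative[OF y[OF nz(2,3)[OF that]] nz(1)[OF that]] open_annulus that])
      (simp add: pu)
  have ppu: "partial_derivative i (partial_derivative j u) x = ?H i j x" if "x \<in> ?S" for x i j
    by (subst partial_derivative_eqI[OF dpu[OF that]]) (simp add: inner_axis', simp add: axis_def)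
  show "hessian u x = (\<chi> i j. ?H i j x)" if "x \<in> ?S"
    unfolding hessian_def using ppu[OF that] by (simp add: vec_eq_iff)
  have cy: "continuous_on {r<..<R} y"
    by (rule DERIV_continuous_on[where D=z]) (auto intro: y has_field_derivative_at_within)
  have norm_in: "norm ` ?S \<subseteq> {r<..<R}" by (auto simp: annulus_def)
  have cy': "continuous_on ?S (\<lambda>x. y (norm x))" and cz': "continuous_on ?S (\<lambda>x. z (norm x))"
    by (rule continuous_on_compose2[OF _ continuous_on_norm_id norm_in], fact)+
  have "continuous_on ?S (?H i j)" for i j
    by (cases "i = j"; simp only: if_True if_False simp_thms; intro continuous_intros cy' cz')
      (use nz in auto)
  then have "continuous_on ?S (partial_derivative i (partial_derivative j u))" for i j
    by (rule continuous_on_eq) (simp add: ppu)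
  with du dpu show "C2_on ?S u"
    unfolding C2_on_def differentiable_def by blast
qed

section \<open>Initial value problems with a parameter\<close>

text \<open>
  The substitution \<open>s = a + t * (r - a)\<close> moves the variable end point into the integrand, so that continuity of
  integrals over a fixed interval with respect to a parameter applies.
\<close>

lemma continuous_on_integral_upto:
  fixes G :: "'m::euclidean_space \<times> real \<Rightarrow> 'e::euclidean_space"
  assumes G: "continuous_on UNIV G"
  shows "continuous_on {z. a \<le> snd z} (\<lambda>z. integral {a..snd z} (\<lambda>s. G (fst z, s)))"
proof -
  have eq: "integral {a..snd z} (\<lambda>s. G (fst z, s))
      = (snd z - a) *\<^sub>R integral (cbox 0 1) (\<lambda>t. G (fst z, a + t * (snd z - a)))"
    if "a \<le> snd z" for z :: "'m \<times> real"
  proof -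
    have le_add: "a + t * (snd z - a) \<le> snd z" if "0 \<le> t" "t \<le> 1" for t
      using mult_left_le_one_le[of "snd z - a" t] that \<open>a \<le> snd z\<close> by simp
    have c: "continuous_on S (\<lambda>s. G (fst z, s))" for S
      by (rule continuous_on_compose2[OF G]) (auto intro!: continuous_intros)
    have "((\<lambda>t. (snd z - a) *\<^sub>R G (fst z, a + t * (snd z - a))) has_integral
       integral {a + 0 * (snd z - a)..a + 1 * (snd z - a)} (\<lambda>s. G (fst z, s))) {0..1}"
      using that
      by (intro has_integral_substitution[where c=a and d="snd z" and f="\<lambda>s. G (fst z, s)"] c)
        (auto intro!: derivative_eq_intros mult_left_le_one_le simp: le_add)
    from integral_unique[OF this] show ?thesis
      by simp
  qed
  have "continuous_on {z. a \<le> snd z}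
     (\<lambda>z. (snd z - a) *\<^sub>R integral (cbox 0 1) (\<lambda>t. G (fst z, a + t * (snd z - a))))"
    by (intro continuous_intros integral_continuous_on_param)
      (auto intro!: continuous_on_compose2[OF G] continuous_intros simp: split_beta)
  then show ?thesis
    by (rule continuous_on_eq) (simp only: mem_Collect_eq eq)
qed

text \<open>
  Making \<open>\<mu>\<close> an argument of the unknown function, next to \<open>r\<close>, makes the fixed point of the integral
  operator jointly continuous in \<open>(\<mu>, r)\<close>.  The iteration runs on \<open>\<psi> = exp (- k (r - a)) \<phi>\<close>: in the sup
  norm of \<open>\<psi>\<close> the integral operator is a contraction with factor \<open>L / k\<close> whatever the length of the
  interval, so one application of the Banach fixed point theorem covers all of \<open>{a..b}\<close>.
\<close>

lemma parametric_picard: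
  fixes F :: "real \<times> real \<Rightarrow> 'e::euclidean_space \<Rightarrow> 'e"
  assumes F: "continuous_on UNIV (\<lambda>(z, x). F z x)"
    and lip: "\<And>z x y. norm (F z x - F z y) \<le> L * norm (x - y)"
    and "L > 0" "a \<le> b" "m0 \<le> m1"
  obtains \<phi> :: "real \<times> real \<Rightarrow> 'e" where
    "continuous_on ({m0..m1} \<times> {a..b}) \<phi>"
    "\<And>\<mu>. \<mu> \<in> {m0..m1} \<Longrightarrow> \<phi> (\<mu>, a) = x0"
    "\<And>\<mu> r. \<mu> \<in> {m0..m1} \<Longrightarrow> r \<in> {a..b} \<Longrightarrow>
      ((\<lambda>r. \<phi> (\<mu>, r)) has_vector_derivative F (\<mu>, r) (\<phi> (\<mu>, r))) (at r within {a..b})"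
proof -
  \<comment> \<open>any \<open>k > L\<close> would do; this one makes the contraction factor \<open>1/2\<close>\<close>
  define k where "k = 2 * L"
  have "k > 0" using \<open>L > 0\<close> by (simp add: k_def)
  let ?K = "cbox (m0, a) (m1, b)"
  have K: "?K = {m0..m1} \<times> {a..b}"
    by (auto simp: cbox_Pair_eq cbox_interval)
  define G where "G = (\<lambda>\<psi> :: (real \<times> real) \<Rightarrow>\<^sub>C 'e. \<lambda>z. F z (exp (k * (snd z - a)) *\<^sub>R apply_bcontfun \<psi> z))"
  define I where "I = (\<lambda>\<psi> :: (real \<times> real) \<Rightarrow>\<^sub>C 'e. \<lambda>z.
     exp (- k * (snd z - a)) *\<^sub>R (x0 + integral {a..snd z} (\<lambda>s. G \<psi> (fst z, s))))"
  have G: "continuous_on UNIV (G \<psi>)" for \<psi>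
  proof -
    have "continuous_on UNIV (\<lambda>z. (z, exp (k * (snd z - a)) *\<^sub>R \<psi> z))"
      by (intro continuous_intros) auto
    from continuous_on_compose2[OF F this] show ?thesis
      by (simp add: G_def)
  qed
  have Gs: "continuous_on S (\<lambda>s. G \<psi> (\<mu>, s))" for \<psi> \<mu> S
    by (rule continuous_on_compose2[OF G]) (auto intro!: continuous_intros)
  have I: "continuous_on ?K (I \<psi>)" for \<psi>
    unfolding I_def
    by (intro continuous_intros continuous_on_subset[OF continuous_on_integral_upto[OF G]])
      (auto simp: K)
  \<comment> \<open>clamping extends the integral operator from the rectangle to a bounded continuous function on the plane\<close>
  have "\<exists>T. \<forall>z. apply_bcontfun T z = I \<psi> (clamp (m0, a) (m1, b) z)" for \<psi>
    using continuous_on_cbox_bcontfunE[OF I] by metis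
  then obtain T where T: "\<And>\<psi> z. apply_bcontfun (T \<psi>) z = I \<psi> (clamp (m0, a) (m1, b) z)"
    by metis
  have "dist (T \<psi>) (T \<xi>) \<le> 1/2 * dist \<psi> \<xi>" for \<psi> \<xi>
  proof (rule dist_bound)
    fix z
    define d where "d = dist \<psi> \<xi>"
    obtain \<mu> r where z: "clamp (m0, a) (m1, b) z = (\<mu>, r)" by fastforce
    have "clamp (m0, a) (m1, b) z \<in> ?K"
      using assms(4,5) by (intro clamp_in_interval) (auto simp: Basis_prod_def)
    then have r: "a \<le> r" unfolding z K by simp
    have bound: "norm (G \<psi> (\<mu>, s) - G \<xi> (\<mu>, s)) \<le> (L * d) * exp (k * (s - a))" for s
    proof -
      have "norm (G \<psi> (\<mu>, s) - G \<xi> (\<mu>, s)) \<le> L * norm (exp (k * (s - a)) *\<^sub>R \<psi> (\<mu>, s) - exp (k * (s - a)) *\<^sub>R \<xi> (\<mu>, s))"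
        unfolding G_def by (rule order_trans[OF lip]) simp
      also have "\<dots> = L * (exp (k * (s - a)) * dist (\<psi> (\<mu>, s)) (\<xi> (\<mu>, s)))"
        by (simp add: dist_norm flip: scaleR_diff_right)
      also have "\<dots> \<le> L * (exp (k * (s - a)) * d)"
        using \<open>L > 0\<close> unfolding d_def by (intro mult_left_mono dist_bounded) auto
      finally show ?thesis by (simp add: algebra_simps)
    qed
    have int: "((\<lambda>s. (L * d) * exp (k * (s - a))) has_integral
        (L * d) / k * exp (k * (r - a)) - (L * d) / k * exp (k * (a - a))) {a..r}"
      using r \<open>k > 0\<close>
      by (intro fundamental_theorem_of_calculus)
        (auto intro!: derivative_eq_intros simp flip: has_real_derivative_iff_has_vector_derivative)
    have "dist (T \<psi> z) (T \<xi> z) = norm (exp (- k * (r - a)) *\<^sub>R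
       (integral {a..r} (\<lambda>s. G \<psi> (\<mu>, s)) - integral {a..r} (\<lambda>s. G \<xi> (\<mu>, s))))"
      unfolding T z I_def by (simp add: dist_norm algebra_simps flip: scaleR_diff_right)
    also have "\<dots> = exp (- k * (r - a)) *
        norm (integral {a..r} (\<lambda>s. G \<psi> (\<mu>, s) - G \<xi> (\<mu>, s)))"
      by (simp add: Henstock_Kurzweil_Integration.integral_diff integrable_continuous_interval Gs)
    also have "\<dots> \<le> exp (- k * (r - a)) * ((L * d) / k * exp (k * (r - a)) - (L * d) / k * exp (k * (a - a)))"
      unfolding integral_unique[OF int, symmetric]
      by (intro mult_left_mono integral_norm_bound_integral bound has_integral_integrable[OF int]
           integrable_continuous_interval continuous_intros Gs) auto
    also have "\<dots> = (L * d) / k - (L * d) / k * exp (- k * (r - a))"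
      by (simp add: algebra_simps exp_add[symmetric] exp_minus divide_simps)
    also have "\<dots> \<le> (L * d) / k"
      using \<open>L > 0\<close> \<open>k > 0\<close> by (simp add: d_def)
    also have "\<dots> = 1/2 * d"
      using \<open>L > 0\<close> by (simp add: k_def)
    finally show "dist (T \<psi> z) (T \<xi> z) \<le> 1/2 * dist \<psi> \<xi>" by (simp add: d_def)
  qed
  then obtain \<psi> where \<psi>: "T \<psi> = \<psi>"
    using banach_fix_type[of "1/2" T] by auto
  define \<phi> where "\<phi> = (\<lambda>z. exp (k * (snd z - a)) *\<^sub>R \<psi> z)"
  have G\<phi>: "G \<psi> = (\<lambda>z. F z (\<phi> z))"
    by (simp add: G_def \<phi>_def)
  have \<phi>: "\<phi> (\<mu>, r) = x0 + integral {a..r} (\<lambda>s. G \<psi> (\<mu>, s))" if "\<mu> \<in> {m0..m1}" "r \<in> {a..b}" for \<mu> r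
  proof -
    have "\<psi> (\<mu>, r) = I \<psi> (clamp (m0, a) (m1, b) (\<mu>, r))"
      using T[of \<psi> "(\<mu>, r)"] \<psi> by simp
    also have "clamp (m0, a) (m1, b) (\<mu>, r) = (\<mu>, r)"
      by (rule clamp_cancel_cbox) (use that in \<open>simp add: K\<close>)
    finally show ?thesis
      by (simp add: \<phi>_def I_def exp_minus)
  qed
  show ?thesis
  proof
    show "continuous_on ({m0..m1} \<times> {a..b}) \<phi>"
      unfolding \<phi>_def by (intro continuous_intros) auto
    show "\<phi> (\<mu>, a) = x0" if "\<mu> \<in> {m0..m1}" for \<mu>
      using \<phi>[OF that, of a] \<open>a \<le> b\<close> by simp
    show "((\<lambda>r. \<phi> (\<mu>, r)) has_vector_derivative F (\<mu>, r) (\<phi> (\<mu>, r))) (at r within {a..b})"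
      if "\<mu> \<in> {m0..m1}" "r \<in> {a..b}" for \<mu> r
    proof (rule has_vector_derivative_transform[OF that(2)])
      show "((\<lambda>r. x0 + integral {a..r} (\<lambda>s. G \<psi> (\<mu>, s))) has_vector_derivative F (\<mu>, r) (\<phi> (\<mu>, r)))
         (at r within {a..b})"
        using integral_has_vector_derivative[OF Gs that(2), of \<psi> \<mu>]
        by (auto intro!: derivative_eq_intros simp: G\<phi>)
    qed (use \<phi>[OF that(1)] in simp)
  qed
qed

text \<open>
  Composing the right-hand side with the projection onto the rectangle makes the hypotheses hold on the whole plane
  and changes nothing on the rectangle.
\<close>

lemma parametric_picard_on:
  fixes F :: "real \<times> real \<Rightarrow> 'e::euclidean_space \<Rightarrow> 'e"
  assumes F: "continuous_on (({m0..m1} \<times> {a..b}) \<times> UNIV) (\<lambda>(z, x). F z x)"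
    and lip: "\<And>z x y. z \<in> {m0..m1} \<times> {a..b} \<Longrightarrow> norm (F z x - F z y) \<le> L * norm (x - y)"
    and "L > 0" "a \<le> b" "m0 \<le> m1"
  obtains \<phi> :: "real \<times> real \<Rightarrow> 'e" where
    "continuous_on ({m0..m1} \<times> {a..b}) \<phi>"
    "\<And>\<mu>. \<mu> \<in> {m0..m1} \<Longrightarrow> \<phi> (\<mu>, a) = x0"
    "\<And>\<mu> r. \<mu> \<in> {m0..m1} \<Longrightarrow> r \<in> {a..b} \<Longrightarrow>
      ((\<lambda>r. \<phi> (\<mu>, r)) has_vector_derivative F (\<mu>, r) (\<phi> (\<mu>, r))) (at r within {a..b})"
proof -
  let ?c = "clamp (m0, a) (m1, b)"
  have K: "cbox (m0, a) (m1, b) = {m0..m1} \<times> {a..b}"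
    by (auto simp: cbox_Pair_eq cbox_interval)
  have c: "?c z \<in> {m0..m1} \<times> {a..b}" for z
    unfolding K[symmetric] using assms(4,5) by (intro clamp_in_interval) (auto simp: Basis_prod_def)
  have "continuous_on UNIV ?c"
    using clamp_continuous_on[OF continuous_on_id] by simp
  from continuous_on_compose2[OF this continuous_on_fst[OF continuous_on_id]]
  have "continuous_on UNIV (\<lambda>p :: _ \<times> 'e. ?c (fst p))" by simp
  then have "continuous_on UNIV (\<lambda>p :: _ \<times> 'e. (?c (fst p), snd p))"
    by (intro continuous_on_Pair continuous_on_snd continuous_on_id)
  then have "continuous_on UNIV (\<lambda>p :: _ \<times> 'e. case (?c (fst p), snd p) of (z, x) \<Rightarrow> F z x)"
    by (rule continuous_on_compose2[OF F]) (use c in \<open>simp add: image_subset_iff\<close>)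
  then have "continuous_on UNIV (\<lambda>(z, x). F (?c z) x)"
    by (simp add: case_prod_unfold)
  from parametric_picard[OF this lip[OF c] assms(3-5), of x0]
  obtain \<phi> :: "real \<times> real \<Rightarrow> 'e" where \<phi>: "continuous_on ({m0..m1} \<times> {a..b}) \<phi>"
    "\<And>\<mu>. \<mu> \<in> {m0..m1} \<Longrightarrow> \<phi> (\<mu>, a) = x0"
    "\<And>\<mu> r. \<mu> \<in> {m0..m1} \<Longrightarrow> r \<in> {a..b} \<Longrightarrow>
      ((\<lambda>r. \<phi> (\<mu>, r)) has_vector_derivative F (?c (\<mu>, r)) (\<phi> (\<mu>, r))) (at r within {a..b})"
    by blast
  have "?c (\<mu>, r) = (\<mu>, r)" if "\<mu> \<in> {m0..m1}" "r \<in> {a..b}" for \<mu> r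
    by (rule clamp_cancel_cbox) (use that in \<open>simp add: K\<close>)
  with \<phi> show ?thesis
    by (intro that[of \<phi>]) auto
qed

section \<open>Elementary estimates\<close>

lemma pucci_real_alt: "pucci_real A B s = A * max s 0 + B * min s 0"
  by (simp add: pucci_real_def)

lemma continuous_on_pucci_real [continuous_intros]:
  "continuous_on S f \<Longrightarrow> continuous_on S (\<lambda>x. pucci_real A B (f x))"
  unfolding pucci_real_alt by (intro continuous_intros)

lemma pucci_real_lipschitz:
  assumes "A > 0" "B > 0"
  shows "\<bar>pucci_real A B s - pucci_real A B t\<bar> \<le> max A B * \<bar>s - t\<bar>"
proof -
  have *: "\<bar>pucci_real A B s - pucci_real A B t\<bar> \<le> max A B * \<bar>s - t\<bar>" if "t \<le> s" for s t
  proof -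
    have "A * (max s 0 - max t 0) \<le> max A B * (max s 0 - max t 0)"
      "B * (min s 0 - min t 0) \<le> max A B * (min s 0 - min t 0)"
      by (intro mult_right_mono; use that in auto)+
    moreover have "0 \<le> A * (max s 0 - max t 0)" "0 \<le> B * (min s 0 - min t 0)"
      by (intro mult_nonneg_nonneg; use that assms in auto)+
    moreover have "max A B * (max s 0 - max t 0) + max A B * (min s 0 - min t 0) = max A B * (s - t)"
      by (simp add: max_def min_def algebra_simps)
    ultimately show ?thesis
      using that by (simp add: pucci_real_alt algebra_simps)
  qed
  show ?thesis
    using *[of s t] *[of t s] by (cases "t \<le> s") (auto simp: abs_minus_commute)
qed

lemma pucci_real_inverse:
  assumes "A > 0" "B > 0"
  shows "pucci_real A B (pucci_real (1/A) (1/B) s) = s"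
  using assms by (auto simp: pucci_real_def zero_le_divide_iff)

lemma pucci_real_scale: "c \<ge> 0 \<Longrightarrow> pucci_real A B (c * s) = c * pucci_real A B s"
  by (auto simp: pucci_real_def zero_le_mult_iff)

text \<open>
  The mean value theorem; the derivative is largest at the right end \<open>C\<close> because \<open>p > 1\<close>.
\<close>

lemma powr_lipschitz:
  fixes p :: real
  assumes "p > 1" "0 \<le> s" "s \<le> C" "0 \<le> t" "t \<le> C"
  shows "\<bar>s powr p - t powr p\<bar> \<le> p * C powr (p - 1) * \<bar>s - t\<bar>"
proof -
  have *: "t powr p - s powr p \<le> p * C powr (p - 1) * (t - s)" if "0 \<le> s" "s < t" "t \<le> C" for s t
  proof -
    have "continuous_on {s..t} (\<lambda>x. x powr p)"
      using that assms(1) by (intro continuous_on_powr' continuous_on_id continuous_on_const) auto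
    moreover have "(\<lambda>x. x powr p) differentiable (at x)" if "s < x" for x
      using has_real_derivative_powr[of x p] that \<open>0 \<le> s\<close>
      by (meson le_less_trans real_differentiable_def)
    ultimately obtain l z where z: "z > s" "z < t" "DERIV (\<lambda>x. x powr p) z :> l"
      "t powr p - s powr p = (t - s) * l"
      using MVT[of s t "\<lambda>x. x powr p"] \<open>s < t\<close> by blast
    have "l = p * z powr (p - 1)"
      using DERIV_unique[OF z(3) has_real_derivative_powr] z(1) that(1) by simp
    moreover have "z powr (p - 1) \<le> C powr (p - 1)"
      using z that assms(1) by (intro powr_mono2) auto
    ultimately have "l \<le> p * C powr (p - 1)"
      using assms(1) by simp
    then show ?thesis
      using that z(4) by (simp add: mult.commute mult_left_mono)
  qed
  show ?thesis
  proof (cases s t rule: linorder_cases)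
    case less
    then show ?thesis using *[of s t] assms powr_mono2[of p s t] by simp
  next
    case greater
    then show ?thesis using *[of t s] assms powr_mono2[of p t s] by simp
  qed simp
qed

lemma continuous_on_positive_part_powr:
  fixes f :: "'a::topological_space \<Rightarrow> real"
  assumes "p > 0" "continuous_on S f"
  shows "continuous_on S (\<lambda>x. max 0 (f x) powr p)"
  using assms by (intro continuous_on_powr' continuous_on_max continuous_on_const) auto

lemma first_nonpos:
  fixes y :: "real \<Rightarrow> real"
  assumes "continuous_on {s..t} y" "s \<le> t" "y t \<le> 0"
  obtains c where "s \<le> c" "c \<le> t" "y c \<le> 0" "\<And>x. s \<le> x \<Longrightarrow> x < c \<Longrightarrow> y x > 0"
proof -
  have "closed {x \<in> {s..t}. y x \<le> 0}"
    using continuous_on_closed_Collect_le[OF assms(1) continuous_on_const closed_atLeastAtMost] .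
  then have "compact ({s..t} \<inter> {x \<in> {s..t}. y x \<le> 0})"
    by (rule compact_Int_closed[OF compact_Icc])
  also have "{s..t} \<inter> {x \<in> {s..t}. y x \<le> 0} = {x \<in> {s..t}. y x \<le> 0}"
    by blast
  finally have "compact {x \<in> {s..t}. y x \<le> 0}" .
  moreover have "t \<in> {x \<in> {s..t}. y x \<le> 0}"
    using assms by simp
  ultimately obtain c where "c \<in> {x \<in> {s..t}. y x \<le> 0}" "\<forall>x\<in>{x \<in> {s..t}. y x \<le> 0}. c \<le> x"
    using continuous_attains_inf[of "{x \<in> {s..t}. y x \<le> 0}" "\<lambda>x. x"] continuous_on_id by blast
  then show ?thesis
    by (intro that[of c]) force+
qed

lemma last_nonpos:
  fixes y :: "real \<Rightarrow> real"
  assumes "continuous_on {s..t} y" "s \<le> t" "y s \<le> 0"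
  obtains c where "s \<le> c" "c \<le> t" "y c \<le> 0" "\<And>x. c < x \<Longrightarrow> x \<le> t \<Longrightarrow> y x > 0"
proof -
  have "continuous_on {-t..-s} (\<lambda>x. y (-x))"
    by (rule continuous_on_compose2[OF assms(1)]) (auto intro!: continuous_intros)
  from first_nonpos[OF this] assms
  obtain c where c: "-t \<le> c" "c \<le> -s" "y (-c) \<le> 0" "\<And>x. -t \<le> x \<Longrightarrow> x < c \<Longrightarrow> y (-x) > 0"
    by auto
  have "y x > 0" if "-c < x" "x \<le> t" for x
    using c(4)[of "-x"] that by simp
  with c show ?thesis
    by (intro that[of "-c"]) auto
qed

section \<open>The radial equation as a first-order system\<close>

text \<open>
  The constants of the radial equation on \<open>{r0..r1}\<close>, where \<open>n\<close> is the multiplicity \<open>N - 1\<close> of the tangential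
  eigenvalue and \<open>a\<close>, \<open>p\<close> are the exponents of the forcing term.
\<close>

locale shooting =
  fixes A B n a p r0 r1 :: real
  assumes A: "A > 0" and B: "B > 0" and n: "n > 0" and p: "p > 1"
    and r0: "0 < r0" and r01: "r0 < r1"
begin

text \<open>
  The power is cut off below \<open>0\<close> and above \<open>r1 - r0\<close>, which makes the system globally Lipschitz.  A trajectory
  that starts with height \<open>0\<close> and slope \<open>1\<close> never exceeds \<open>r1 - r0\<close> (lemma \<open>v_le\<close>), and as long as it is
  nonnegative the cut-off is invisible (lemma \<open>force_eq\<close>).
\<close>

definition force :: "real \<Rightarrow> real \<Rightarrow> real \<Rightarrow> real" where
  "force \<mu> r s = \<mu> * r powr a * (max 0 (min s (r1 - r0))) powr p"

text \<open>
  The second-order equation solved for \<open>v''\<close>, as a system for \<open>(v, y)\<close> with \<open>y = v'\<close>.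
\<close>

definition rhs :: "real \<times> real \<Rightarrow> real \<times> real \<Rightarrow> real \<times> real" where
  "rhs = (\<lambda>(\<mu>, r) (v, y). (y, pucci_real (1/A) (1/B) (- force \<mu> r v - n / r * pucci_real A B y)))"

definition \<kappa>\<^sub>0 where "\<kappa>\<^sub>0 = min (r0 powr a) (r1 powr a)"
definition \<kappa>\<^sub>1 where "\<kappa>\<^sub>1 = max (r0 powr a) (r1 powr a)"

text \<open>
  The exponent for which \<open>r\<^sup>K v'\<close> is nonincreasing wherever \<open>v' \<le> 0\<close>, see \<open>W_deriv_le\<close>.
\<close>

definition K where "K = n * B / min A B"

lemma \<kappa>\<^sub>0_pos: "\<kappa>\<^sub>0 > 0"
  using r0 r01 by (simp add: \<kappa>\<^sub>0_def)

lemma \<kappa>\<^sub>1_pos: "\<kappa>\<^sub>1 > 0"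
  using r0 by (simp add: \<kappa>\<^sub>1_def less_max_iff_disj)

lemma weight_bounds:
  assumes "r0 \<le> r" "r \<le> r1"
  shows "\<kappa>\<^sub>0 \<le> r powr a" "r powr a \<le> \<kappa>\<^sub>1"
proof -
  have "r0 powr a \<le> r powr a \<and> r powr a \<le> r1 powr a \<or> r1 powr a \<le> r powr a \<and> r powr a \<le> r0 powr a"
    using assms r0 r01 by (cases "a \<ge> 0") (auto intro: powr_mono2 powr_mono2')
  then show "\<kappa>\<^sub>0 \<le> r powr a" "r powr a \<le> \<kappa>\<^sub>1"
    by (auto simp: \<kappa>\<^sub>0_def \<kappa>\<^sub>1_def)
qed

lemma rhs_continuous: "continuous_on (({m0..m1} \<times> {r0..r1}) \<times> UNIV) (\<lambda>(z, x). rhs z x)"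
  (is "continuous_on ?X _")
proof -
  have eq: "(\<lambda>(z, x). rhs z x) = (\<lambda>q. (snd (snd q), pucci_real (1/A) (1/B) (
     - (fst (fst q) * snd (fst q) powr a * (max 0 (min (fst (snd q)) (r1 - r0))) powr p)
       - n / snd (fst q) * pucci_real A B (snd (snd q)))))"
    by (auto simp: rhs_def force_def fun_eq_iff)
  have 1: "continuous_on ?X (\<lambda>q. (max 0 (min (fst (snd q)) (r1 - r0))) powr p)"
    using p by (intro continuous_on_positive_part_powr continuous_intros) auto
  have 2: "continuous_on ?X (\<lambda>q. snd (fst q) powr a)"
    using r0 by (intro continuous_on_powr continuous_intros) auto
  show ?thesis
    unfolding eq using r0
    by (intro 1 2 continuous_on_Pair continuous_on_pucci_real continuous_on_diff continuous_on_minus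
      continuous_on_mult continuous_on_divide continuous_on_fst continuous_on_snd
      continuous_on_id continuous_on_const) auto
qed

lemma rhs_lipschitz:
  assumes "m1 \<ge> 0"
  obtains L where "L > 0" "\<And>z x y. z \<in> {0..m1} \<times> {r0..r1} \<Longrightarrow> norm (rhs z x - rhs z y) \<le> L * norm (x - y)"
proof -
  define D where "D = m1 * \<kappa>\<^sub>1 * (p * (r1 - r0) powr (p - 1))"
  define E where "E = n / r0 * max A B"
  define L where "L = 1 + max (1/A) (1/B) * (D + E)"
  have D: "D \<ge> 0" unfolding D_def using assms \<kappa>\<^sub>1_pos p by simp
  have E: "E \<ge> 0" unfolding E_def using n r0 A by (simp add: le_max_iff_disj)
  have "L > 0" unfolding L_def using D E A by (smt (verit) divide_pos_pos max.cobounded1 mult_nonneg_nonneg)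
  moreover have "norm (rhs z x - rhs z x') \<le> L * norm (x - x')" if z: "z \<in> {0..m1} \<times> {r0..r1}" for z x x'
  proof -
    obtain \<mu> r where zz: "z = (\<mu>, r)" by fastforce
    obtain v y where x: "x = (v, y)" by fastforce
    obtain v' y' where x': "x' = (v', y')" by fastforce
    define d where "d = norm (x - x')"
    have mr: "0 \<le> \<mu>" "\<mu> \<le> m1" "r0 \<le> r" "r \<le> r1" using z zz by auto
    have dv: "\<bar>v - v'\<bar> \<le> d" and dy: "\<bar>y - y'\<bar> \<le> d"
      using norm_fst_le[of "v - v'" "y - y'"] norm_snd_le[of "y - y'" "v - v'"] by (simp_all add: x x' d_def)
    define g where "g = (\<lambda>s. max 0 (min s (r1 - r0)))"
    have "\<bar>g v powr p - g v' powr p\<bar> \<le> p * (r1 - r0) powr (p - 1) * \<bar>g v - g v'\<bar>"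
      using r01 p by (intro powr_lipschitz) (auto simp: g_def)
    also have "\<dots> \<le> p * (r1 - r0) powr (p - 1) * d"
      using p dv by (intro mult_left_mono) (auto simp: g_def)
    finally have g: "\<bar>g v powr p - g v' powr p\<bar> \<le> p * (r1 - r0) powr (p - 1) * d" .
    have "\<mu> * r powr a * \<bar>g v powr p - g v' powr p\<bar> \<le> (m1 * \<kappa>\<^sub>1) * (p * (r1 - r0) powr (p - 1) * d)"
      using mr weight_bounds[of r] \<kappa>\<^sub>1_pos g by (intro mult_mono) auto
    moreover have "force \<mu> r v - force \<mu> r v' = \<mu> * r powr a * (g v powr p - g v' powr p)"
      unfolding force_def g_def by (simp add: algebra_simps)
    then have "\<bar>force \<mu> r v - force \<mu> r v'\<bar> = \<mu> * r powr a * \<bar>g v powr p - g v' powr p\<bar>"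
      using mr by (simp add: abs_mult)
    ultimately have f: "\<bar>force \<mu> r v - force \<mu> r v'\<bar> \<le> D * d"
      by (simp only: D_def mult.assoc)
    have "\<bar>n / r * pucci_real A B y - n / r * pucci_real A B y'\<bar> = n / r * \<bar>pucci_real A B y - pucci_real A B y'\<bar>"
      unfolding right_diff_distrib[symmetric] using n r0 mr by (simp add: abs_mult)
    also have "\<dots> \<le> n / r0 * (max A B * d)"
    proof (intro mult_mono)
      show "\<bar>pucci_real A B y - pucci_real A B y'\<bar> \<le> max A B * d"
        using pucci_real_lipschitz[OF A B, of y y'] dy A
        by (smt (verit) max.cobounded1 mult_left_mono)
    qed (use n r0 mr in \<open>auto intro: divide_left_mono\<close>)
    finally have P: "\<bar>n / r * pucci_real A B y - n / r * pucci_real A B y'\<bar> \<le> E * d"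
      by (simp add: E_def algebra_simps)
    have "\<bar>pucci_real (1/A) (1/B) (- force \<mu> r v - n / r * pucci_real A B y) -
        pucci_real (1/A) (1/B) (- force \<mu> r v' - n / r * pucci_real A B y')\<bar>
      \<le> max (1/A) (1/B) * \<bar>(- force \<mu> r v - n / r * pucci_real A B y) - (- force \<mu> r v' - n / r * pucci_real A B y')\<bar>"
      using A B by (intro pucci_real_lipschitz) auto
    also have "\<dots> \<le> max (1/A) (1/B) * ((D + E) * d)"
      using f P A by (intro mult_left_mono) (auto simp: algebra_simps le_max_iff_disj)
    finally have Q: "\<bar>pucci_real (1/A) (1/B) (- force \<mu> r v - n / r * pucci_real A B y) -
        pucci_real (1/A) (1/B) (- force \<mu> r v' - n / r * pucci_real A B y')\<bar> \<le> max (1/A) (1/B) * ((D + E) * d)" .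
    have "norm (rhs z x - rhs z x') \<le> \<bar>y - y'\<bar> + \<bar>pucci_real (1/A) (1/B) (- force \<mu> r v - n / r * pucci_real A B y) -
        pucci_real (1/A) (1/B) (- force \<mu> r v' - n / r * pucci_real A B y')\<bar>"
      unfolding zz x x' rhs_def by (simp add: norm_Pair_le[THEN order_trans])
    also have "\<dots> \<le> d + max (1/A) (1/B) * ((D + E) * d)"
      by (intro add_mono dy Q)
    also have "\<dots> = L * d" by (simp add: L_def algebra_simps)
    finally show ?thesis by (simp add: d_def)
  qed
  ultimately show ?thesis by (rule that)
qed

end

section \<open>Monotonicity on an interval\<close>

text \<open>
  Solutions of initial value problems have derivatives within the closed interval \<open>{a..b}\<close>, and their signs are
  known only in the interior of the subinterval in question.
\<close>

lemma nonincreasing_within: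
  fixes h :: "real \<Rightarrow> real"
  assumes h: "\<And>x. x \<in> {a..b} \<Longrightarrow> (h has_real_derivative h' x) (at x within {a..b})"
    and "a \<le> s" "s \<le> t" "t \<le> b" and h': "\<And>x. s < x \<Longrightarrow> x < t \<Longrightarrow> h' x \<le> 0"
  shows "h t \<le> h s"
proof (rule DERIV_nonpos_imp_decreasing_open[OF \<open>s \<le> t\<close>])
  fix x assume x: "s < x" "x < t"
  then have "at x within {a..b} = at x"
    using assms by (intro at_within_Icc_at) auto
  with h[of x] x assms show "\<exists>y. DERIV h x :> y \<and> y \<le> 0"
    by (intro exI[of _ "h' x"]) auto
next
  have "continuous_on {a..b} h"
    by (rule DERIV_continuous_on[OF h])
  then show "continuous_on {s..t} h"
    by (rule continuous_on_subset) (use assms in auto)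
qed

lemma nondecreasing_within:
  fixes h :: "real \<Rightarrow> real"
  assumes h: "\<And>x. x \<in> {a..b} \<Longrightarrow> (h has_real_derivative h' x) (at x within {a..b})"
    and "a \<le> s" "s \<le> t" "t \<le> b" and h': "\<And>x. s < x \<Longrightarrow> x < t \<Longrightarrow> h' x \<ge> 0"
  shows "h s \<le> h t"
  using nonincreasing_within[of a b "\<lambda>x. - h x" "\<lambda>x. - h' x" s t] assms
  by (auto intro: DERIV_minus)

lemma increasing_within:
  fixes h :: "real \<Rightarrow> real"
  assumes h: "\<And>x. x \<in> {a..b} \<Longrightarrow> (h has_real_derivative h' x) (at x within {a..b})"
    and "a \<le> s" "s < t" "t \<le> b" and h': "\<And>x. s < x \<Longrightarrow> x < t \<Longrightarrow> h' x > 0"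
  shows "h s < h t"
proof (rule DERIV_pos_imp_increasing_open[OF \<open>s < t\<close>])
  fix x assume x: "s < x" "x < t"
  then have "at x within {a..b} = at x"
    using assms by (intro at_within_Icc_at) auto
  with h[of x] x assms show "\<exists>y. DERIV h x :> y \<and> y > 0"
    by (intro exI[of _ "h' x"]) auto
next
  have "continuous_on {a..b} h"
    by (rule DERIV_continuous_on[OF h])
  then show "continuous_on {s..t} h"
    by (rule continuous_on_subset) (use assms in auto)
qed

text \<open>
  The integrating factor \<open>r\<^sup>k\<close> removes a term \<open>- k y / r\<close> from the derivative of \<open>y\<close>.
\<close>

lemma powr_weighted_derivative:
  fixes y :: "real \<Rightarrow> real"
  assumes "x > 0" "(y has_real_derivative D) (at x within S)"
  shows "((\<lambda>r. r powr k * y r) has_real_derivative x powr k * (k * y x / x + D)) (at x within S)"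
proof -
  have "((\<lambda>r. r powr k) has_real_derivative k * x powr (k - 1)) (at x within S)"
    using has_real_derivative_powr[OF assms(1)] has_field_derivative_at_within by blast
  from DERIV_mult[OF this assms(2)] show ?thesis
    by (rule DERIV_cong) (use assms(1) in \<open>simp add: powr_diff field_simps\<close>)
qed

section \<open>Shape of a trajectory\<close>

locale trajectory = shooting +
  fixes \<mu> :: real and v y :: "real \<Rightarrow> real"
  assumes \<mu>: "\<mu> \<ge> 0" and v0: "v r0 = 0" and y0: "y r0 = 1"
    and dv: "\<And>r. r \<in> {r0..r1} \<Longrightarrow> (v has_real_derivative y r) (at r within {r0..r1})"
    and dy: "\<And>r. r \<in> {r0..r1} \<Longrightarrow>
      (y has_real_derivative pucci_real (1/A) (1/B) (- force \<mu> r (v r) - n / r * pucci_real A B (y r)))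
        (at r within {r0..r1})"
begin

abbreviation y' where "y' r \<equiv> pucci_real (1/A) (1/B) (- force \<mu> r (v r) - n / r * pucci_real A B (y r))"

lemma force_nonneg: "force \<mu> r s \<ge> 0"
  using \<mu> by (simp add: force_def)

lemma y_cont: "continuous_on S y" if "S \<subseteq> {r0..r1}"
  using continuous_on_subset[OF DERIV_continuous_on[OF dy] that] by blast

lemma y'_nonneg_slope:
  assumes "y r \<ge> 0" "r \<ge> r0"
  shows "y' r = - (force \<mu> r (v r) / B + n * A * y r / r / B)"
proof -
  have "n / r * pucci_real A B (y r) = n * A * y r / r" using assms by (simp add: pucci_real_def)
  then have eq: "- force \<mu> r (v r) - n / r * pucci_real A B (y r) = - (force \<mu> r (v r) + n * A * y r / r)"
    by simp
  have "n * A * y r / r \<ge> 0" using assms n A r0 by simp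
  moreover have "pucci_real (1/A) (1/B) s = s / B" if "s \<le> 0" for s
    using that by (auto simp: pucci_real_def)
  ultimately have "y' r = - (force \<mu> r (v r) + n * A * y r / r) / B"
    using force_nonneg[of r "v r"] unfolding eq by simp
  also have "\<dots> = - (force \<mu> r (v r) / B + n * A * y r / r / B)"
    by (simp only: minus_divide_left[symmetric] add_divide_distrib)
  finally show ?thesis .
qed

lemma slope_decreasing_if_nonneg:
  assumes "y r \<ge> 0" "r \<ge> r0"
  shows "y' r \<le> 0"
proof -
  have "n * A * y r / r / B \<ge> 0" using assms n A B r0 by simp
  moreover have "force \<mu> r (v r) / B \<ge> 0" using force_nonneg B by simp
  ultimately show ?thesis
    unfolding y'_nonneg_slope[OF assms] by simp
qed

text \<open>
  For \<open>y \<le> 0\<close> the forcing and the tangential term have opposite signs, so either branch of the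
  inverse of \<open>pucci_real A B\<close> may be active.  Dividing the positive part by the smaller and the negative part by the larger
  of \<open>A\<close>, \<open>B\<close> bounds both branches.
\<close>

lemma y'_nonpos_slope:
  assumes "y r \<le> 0" "r \<ge> r0"
  shows "y' r \<le> - force \<mu> r (v r) / max A B - K * y r / r"
proof -
  define f g where "f = force \<mu> r (v r)" and "g = n * B * (- y r) / r"
  have f: "f \<ge> 0" by (simp add: f_def force_nonneg)
  have g: "g \<ge> 0" unfolding g_def using assms n B r0 by (intro divide_nonneg_pos mult_nonneg_nonneg) auto
  have "n / r * pucci_real A B (y r) = - g" using assms by (auto simp: pucci_real_def g_def)
  then have "y' r = pucci_real (1/A) (1/B) (g - f)" by (simp add: f_def)
  also have "\<dots> \<le> g / min A B - f / max A B"
  proof -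
    have 1: "g / A \<le> g / min A B" "g / B \<le> g / min A B"
      using g A B by (auto intro!: divide_left_mono)
    have 2: "f / max A B \<le> f / A" "f / max A B \<le> f / B"
      using f A B by (auto intro!: divide_left_mono simp: less_max_iff_disj)
    have "pucci_real (1/A) (1/B) (g - f) = g / A - f / A \<or> pucci_real (1/A) (1/B) (g - f) = g / B - f / B"
      by (auto simp: pucci_real_def diff_divide_distrib)
    with 1 2 show ?thesis by linarith
  qed
  finally show ?thesis by (simp add: f_def g_def K_def algebra_simps)
qed

text \<open>
  A positive slope never increases, so the slope cannot climb from a nonpositive value to a positive one.
\<close>

lemma slope_stays_nonpos:
  assumes "r0 \<le> s" "s \<le> t" "t \<le> r1" "y s \<le> 0"
  shows "y t \<le> 0"
proof -
  obtain c where c: "s \<le> c" "c \<le> t" "y c \<le> 0" "\<And>x. c < x \<Longrightarrow> x \<le> t \<Longrightarrow> y x > 0"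
    using last_nonpos[OF y_cont, of s t] assms by auto
  have "y t \<le> y c"
  proof (rule nonincreasing_within[OF dy])
    fix x assume x: "c < x" "x < t"
    then have "y x > 0" "x \<ge> r0" using c assms by auto
    then show "y' x \<le> 0"
      using slope_decreasing_if_nonneg[of x] by simp
  qed (use c assms in auto)
  with c show ?thesis by simp
qed

lemma slope_nonincreasing:
  assumes "r0 \<le> s" "s \<le> t" "t \<le> r1" "y t > 0"
  shows "y t \<le> y s"
proof (rule nonincreasing_within[OF dy])
  fix x assume x: "s < x" "x < t"
  then have "y x > 0" "x \<ge> r0" using slope_stays_nonpos[of x t] assms by force+
  then show "y' x \<le> 0"
    using slope_decreasing_if_nonneg[of x] by simp
qed (use assms in auto)

lemma slope_le_1: "r0 \<le> r \<Longrightarrow> r \<le> r1 \<Longrightarrow> y r \<le> 1"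
  using slope_nonincreasing[of r0 r] y0 by (cases "y r > 0") auto

lemma v_le:
  assumes "r0 \<le> r" "r \<le> r1"
  shows "v r \<le> r1 - r0"
proof -
  have "v r - r \<le> v r0 - r0"
    by (rule nonincreasing_within[of r0 r1 "\<lambda>x. v x - x" "\<lambda>x. y x - 1"])
      (use assms slope_le_1 in \<open>auto intro!: derivative_intros dv\<close>)
  then show ?thesis using assms v0 by simp
qed

lemma force_eq:
  assumes "r0 \<le> r" "r \<le> r1" "v r \<ge> 0"
  shows "force \<mu> r (v r) = \<mu> * r powr a * v r powr p"
  using assms v_le by (simp add: force_def)

lemma force_le:
  assumes "r0 \<le> r" "r \<le> r1" "0 \<le> v r" "v r \<le> s"
  shows "force \<mu> r (v r) \<le> \<mu> * \<kappa>\<^sub>1 * s powr p"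
  unfolding force_eq[OF assms(1-3)]
  using assms \<mu> weight_bounds[of r] \<kappa>\<^sub>0_pos p by (intro mult_mono powr_mono2) auto

lemma force_ge:
  assumes "r0 \<le> r" "r \<le> r1" "0 \<le> s" "s \<le> v r"
  shows "\<mu> * \<kappa>\<^sub>0 * s powr p \<le> force \<mu> r (v r)"
  using assms \<mu> weight_bounds[of r] \<kappa>\<^sub>0_pos p
  by (subst force_eq) (auto intro!: mult_mono powr_mono2)

text \<open>
  A trajectory whose slope is nonpositive somewhere has a turning point \<open>c\<close>: it rises up to \<open>c\<close> and does not
  rise after \<open>c\<close>.
\<close>

lemma turning_point:
  assumes "r0 \<le> t" "t \<le> r1" "y t \<le> 0"
  obtains c where "r0 < c" "c \<le> t" "y c \<le> 0" "\<And>x. r0 \<le> x \<Longrightarrow> x < c \<Longrightarrow> y x > 0"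
    "\<And>x. c \<le> x \<Longrightarrow> x \<le> r1 \<Longrightarrow> y x \<le> 0"
proof -
  obtain c where c: "r0 \<le> c" "c \<le> t" "y c \<le> 0" "\<And>x. r0 \<le> x \<Longrightarrow> x < c \<Longrightarrow> y x > 0"
    using first_nonpos[OF y_cont, of r0 t] assms by auto
  have "c \<noteq> r0" using c(3) y0 by auto
  then have "r0 < c" using c(1) by simp
  moreover have "y x \<le> 0" if "c \<le> x" "x \<le> r1" for x
    using slope_stays_nonpos[of c x] c(1,3) that by blast
  ultimately show ?thesis
    using that c by blast
qed

lemma v_increasing:
  assumes "r0 \<le> s" "s < t" "t \<le> r1" "\<And>x. r0 \<le> x \<Longrightarrow> x < t \<Longrightarrow> y x > 0"
  shows "v s < v t"
  by (rule increasing_within[OF dv]) (use assms in auto)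

definition W where "W r = r powr K * y r"

lemma W_deriv:
  assumes "r \<in> {r0..r1}"
  shows "(W has_real_derivative r powr K * (K * y r / r + y' r)) (at r within {r0..r1})"
  unfolding W_def[abs_def]
  by (rule powr_weighted_derivative[OF _ dy[OF assms]]) (use assms r0 in auto)

lemma W_deriv_le:
  assumes "r \<in> {r0..r1}" "y r \<le> 0"
  shows "r powr K * (K * y r / r + y' r) \<le> - (r powr K * (force \<mu> r (v r) / max A B))"
proof -
  have "r powr K * (K * y r / r + y' r) \<le> r powr K * (- (force \<mu> r (v r) / max A B))"
    using y'_nonpos_slope[of r] assms by (intro mult_left_mono) auto
  then show ?thesis by simp
qed

text \<open>
  After the turning point the trajectory is concave with respect to a new radial variable with differential
  \<open>r\<^bsup>-K\<^esup> dr\<close>.  This replaces concavity in \<open>r\<close>, which can fail where \<open>y < 0\<close>.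
\<close>

lemma W_nonincreasing:
  assumes "r0 \<le> c" "c \<le> s" "s \<le> t" "t \<le> r1" "y c \<le> 0"
  shows "W t \<le> W s"
proof (rule nonincreasing_within[OF W_deriv])
  fix x assume x: "s < x" "x < t"
  then have "y x \<le> 0" using slope_stays_nonpos[of c x] assms by auto
  moreover have "0 \<le> x powr K * (force \<mu> x (v x) / max A B)"
    using force_nonneg A by (simp add: le_max_iff_disj)
  ultimately show "x powr K * (K * y x / x + y' x) \<le> 0"
    using W_deriv_le[of x] x assms by simp
qed (use assms in auto)

lemma W_neg_iff: "r \<ge> r0 \<Longrightarrow> W r < 0 \<longleftrightarrow> y r < 0"
  using r0 by (simp add: W_def mult_less_0_iff)

text \<open>
  Up to the turning point the trajectory rises from \<open>0\<close>.  If it came down to a value \<open>\<le> 0\<close> at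
  \<open>z < r1\<close>, its slope would be negative somewhere before \<open>z\<close>, hence by \<open>W_nonincreasing\<close> at all later points, and \<open>v r1\<close> would be negative.
\<close>

lemma v_positive:
  assumes end_nonneg: "v r1 \<ge> 0" and z: "r0 < z" "z < r1"
  shows "v z > 0"
proof (cases "y z > 0")
  case True
  then have "y x > 0" if "r0 \<le> x" "x < z" for x
    using slope_stays_nonpos[of x z] that z by force
  then show ?thesis using v_increasing[of r0 z] z v0 by simp
next
  case False
  then have "r0 \<le> z" "z \<le> r1" "y z \<le> 0" using z by auto
  then obtain c where c: "r0 < c" "c \<le> z" "y c \<le> 0" "\<And>x. r0 \<le> x \<Longrightarrow> x < c \<Longrightarrow> y x > 0"
    "\<And>x. c \<le> x \<Longrightarrow> x \<le> r1 \<Longrightarrow> y x \<le> 0"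
    by (rule turning_point) blast
  have vc: "v c > 0" using v_increasing[of r0 c] c z v0 by simp
  show ?thesis
  proof (rule ccontr)
    assume neg: "\<not> v z > 0"
    have "\<exists>\<xi>. c < \<xi> \<and> \<xi> < z \<and> y \<xi> < 0"
    proof (rule ccontr)
      assume "\<not> ?thesis"
      then have "v c \<le> v z"
        by (intro nondecreasing_within[OF dv]) (use c z in force)+
      with neg vc show False by simp
    qed
    then obtain \<xi> where \<xi>: "c < \<xi>" "\<xi> < z" "y \<xi> < 0" by blast
    have "y x < 0" if "\<xi> \<le> x" "x \<le> r1" for x
      using W_nonincreasing[of c \<xi> x] W_neg_iff[of \<xi>] W_neg_iff[of x] \<xi> c that by simp
    then have "- v z < - v r1"
      by (intro increasing_within[of r0 r1 "\<lambda>x. - v x" "\<lambda>x. - y x"] DERIV_minus dv)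
        (use \<xi> z c in auto)
    with end_nonneg neg show False by simp
  qed
qed

text \<open>
  Without forcing \<open>r\<^bsup>n A / B\<^esup> y\<close> is constant while the slope is positive, so the slope never reaches \<open>0\<close>.
\<close>

lemma v_end_positive_if_unforced:
  assumes "\<mu> = 0"
  shows "v r1 > 0"
proof -
  have "y t > 0" if t: "r0 \<le> t" "t \<le> r1" for t
  proof (rule ccontr)
    assume "\<not> y t > 0"
    then have "y t \<le> 0" by simp
    with t obtain c where c: "r0 < c" "c \<le> t" "y c \<le> 0" "\<And>x. r0 \<le> x \<Longrightarrow> x < c \<Longrightarrow> y x > 0"
      by (rule turning_point) blast
    define k where "k = n * A / B"
    have d: "((\<lambda>r. r powr k * y r) has_real_derivative x powr k * (k * y x / x + y' x))
       (at x within {r0..r1})" if "x \<in> {r0..r1}" for x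
      by (rule powr_weighted_derivative[OF _ dy[OF that]]) (use that r0 in auto)
    have "r0 powr k * y r0 \<le> c powr k * y c"
    proof (rule nondecreasing_within[OF d])
      fix x assume x: "r0 < x" "x < c"
      then have "y' x = - k * y x / x"
        using y'_nonneg_slope[of x] c(4)[of x] assms by (simp add: force_def k_def)
      then show "0 \<le> x powr k * (k * y x / x + y' x)" by simp
    qed (use c t in auto)
    moreover have "c powr k * y c \<le> 0" using c(3) by (simp add: mult_nonneg_nonpos)
    moreover have "r0 powr k * y r0 > 0" using y0 r0 by simp
    ultimately show False by simp
  qed
  then show ?thesis using v_increasing[of r0 r1] r01 v0 by simp
qed

end

section \<open>Bound on the forcing strength\<close>

context shooting begin

text \<open>
  The interval is cut into four pieces of length \<open>\<delta>\<close>, since the two cases below are whether the slope is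
  still positive in the middle or not.  The number \<open>\<rho>\<close> bounds all ratios of values of the weight \<open>r\<^sup>K\<close>, and \<open>\<theta>\<close>
  bounds the height at a turning point in the first half by a multiple of the height at \<open>r0 + 3 * \<delta>\<close>.  The
  constants \<open>C\<^sub>1\<close> and \<open>C\<^sub>2\<close> are large enough for both cases; the first term of \<open>C\<^sub>2\<close> is the slope left over when
  the trajectory still rises.
\<close>

definition "\<delta> = (r1 - r0) / 4"
definition "\<rho> = (r1 / r0) powr K"
definition "\<theta> = 1 + 4 * \<rho>\<^sup>2"
definition "C\<^sub>1 = \<rho>\<^sup>2 * max A B / (\<kappa>\<^sub>0 * \<delta>\<^sup>2)"
definition "C\<^sub>2 = 1 / \<delta> + n * A * \<theta> / (r0 * B) + 4 * \<kappa>\<^sub>1 * \<theta> powr p * \<delta> / B"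

lemma \<delta>: "\<delta> > 0" "r1 = r0 + 4 * \<delta>"
  using r01 by (auto simp: \<delta>_def field_simps)

lemma \<rho>: "\<rho> \<ge> 1"
  unfolding \<rho>_def K_def using r0 r01 n A B by (intro ge_one_powr_ge_zero) auto

lemma \<theta>: "\<theta> \<ge> 1" by (simp add: \<theta>_def)

text \<open>
  Inserting the upper estimate into the lower one bounds \<open>U\<close> from below; dividing the upper one by \<open>U\<close> then
  bounds \<open>\<mu>\<close>, since \<open>p > 1\<close>.
\<close>

lemma strength_bound_aux:
  assumes "U > 0" "\<mu> \<ge> 0"
    and upper: "\<mu> * U powr p \<le> C\<^sub>1 * U" and lower: "1 \<le> C\<^sub>2 * (U + \<mu> * U powr p)"
  shows "\<mu> \<le> C\<^sub>1 * (C\<^sub>2 * (1 + C\<^sub>1)) powr (p - 1)"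
proof -
  have C1: "C\<^sub>1 > 0" unfolding C\<^sub>1_def using \<kappa>\<^sub>0_pos \<delta> \<rho> A by (auto simp: less_max_iff_disj)
  have C2: "C\<^sub>2 > 0" unfolding C\<^sub>2_def using \<kappa>\<^sub>1_pos \<delta> \<theta> A B n r0
    by (intro add_pos_pos divide_pos_pos mult_pos_pos) auto
  have "1 \<le> C\<^sub>2 * (U + C\<^sub>1 * U)"
    using lower mult_left_mono[OF add_left_mono[OF upper, of U] less_imp_le[OF C2]] by linarith
  then have "1 / U \<le> C\<^sub>2 * (1 + C\<^sub>1)"
    using \<open>U > 0\<close> by (simp add: field_simps)
  then have *: "(1 / U) powr (p - 1) \<le> (C\<^sub>2 * (1 + C\<^sub>1)) powr (p - 1)"
    using p \<open>U > 0\<close> by (intro powr_mono2) auto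
  have "U powr p = U * U powr (p - 1)"
    using \<open>U > 0\<close> powr_add[of U 1 "p - 1"] by simp
  then have "\<mu> * U powr (p - 1) \<le> C\<^sub>1"
    using upper \<open>U > 0\<close> by simp
  then have "\<mu> \<le> C\<^sub>1 / U powr (p - 1)"
    using \<open>U > 0\<close> by (simp add: field_simps)
  also have "\<dots> = C\<^sub>1 * (1 / U) powr (p - 1)"
    using \<open>U > 0\<close> by (simp add: powr_divide)
  also have "\<dots> \<le> C\<^sub>1 * (C\<^sub>2 * (1 + C\<^sub>1)) powr (p - 1)"
    using * C1 by simp
  finally show ?thesis .
qed

end

lemma has_derivative_add_linear:
  fixes f :: "real \<Rightarrow> real"
  assumes "(f has_real_derivative D) (at x within S)"
  shows "((\<lambda>x. f x + k * x) has_real_derivative D + k) (at x within S)"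
  using DERIV_add[OF assms DERIV_cmult[OF DERIV_ident, of k]] by simp

context trajectory begin

text \<open>
  While the trajectory rises, its slope decreases at the rate \<open>(force + n A v' / r) / B\<close>; integrated up to \<open>s\<close> this
  bounds the loss of slope by the height reached.
\<close>

lemma initial_slope_bound:
  assumes s: "r0 \<le> s" "s \<le> r1" and pos: "\<And>x. r0 \<le> x \<Longrightarrow> x < s \<Longrightarrow> y x > 0"
    and vs: "v s \<le> V"
  shows "1 \<le> y s + n * A / (r0 * B) * V + \<mu> * \<kappa>\<^sub>1 * V powr p / B * (s - r0)"
proof -
  define E where "E = \<mu> * \<kappa>\<^sub>1 * V powr p / B"
  let ?H = "\<lambda>r. y r + n * A / (r0 * B) * v r + E * r"
  have v_mono: "v x \<le> v t" if "r0 \<le> x" "x \<le> t" "t \<le> s" for x t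
    using v_increasing[of x t] pos that s by (cases "x = t") force+
  have "?H r0 \<le> ?H s"
  proof (rule nondecreasing_within[where h = ?H and a = r0 and b = r1])
    show "(?H has_real_derivative y' x + n * A / (r0 * B) * y x + E) (at x within {r0..r1})"
      if "x \<in> {r0..r1}" for x
      using that by (intro has_derivative_add_linear DERIV_add DERIV_cmult dv dy)
    fix x assume x: "r0 < x" "x < s"
    then have yx: "y x > 0" using pos by simp
    have "v x \<ge> 0" "v x \<le> V" using v_mono[of r0 x] v_mono[of x s] v0 vs x by auto
    then have f1: "force \<mu> x (v x) / B \<le> E"
      unfolding E_def using force_le[of x V] x s B by (intro divide_right_mono) auto
    have "n * A * y x / x \<le> n * A * y x / r0"
      using x yx n A r0 by (intro divide_left_mono) auto
    then have f2: "n * A * y x / x / B \<le> n * A * y x / r0 / B"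
      using B by (intro divide_right_mono) auto
    show "0 \<le> y' x + n * A / (r0 * B) * y x + E"
    proof -
      have "y' x = - (force \<mu> x (v x) / B + n * A * y x / x / B)"
        using y'_nonneg_slope[of x] yx x by simp
      moreover have "n * A / (r0 * B) * y x = n * A * y x / r0 / B" by simp
      ultimately show ?thesis using f1 f2 by linarith
    qed
  qed (use s in auto)
  moreover have "n * A / (r0 * B) * v s \<le> n * A / (r0 * B) * V"
    using vs n A B r0 by (intro mult_left_mono) auto
  moreover have "\<mu> * \<kappa>\<^sub>1 * V powr p / B * (s - r0) = E * s - E * r0"
    by (simp add: E_def right_diff_distrib)
  moreover have "y r0 + n * A / (r0 * B) * v r0 = 1" using y0 v0 by simp
  ultimately show ?thesis by linarith
qed

text \<open>
  If the trajectory still rises at the middle \<open>m = r0 + 2 * \<delta>\<close>, take \<open>q = r0 + \<delta>\<close> and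
  \<open>U = v q\<close>.  Concavity on the rising part bounds the slope at \<open>q\<close> by \<open>U / \<delta>\<close>.  Between \<open>q\<close> and \<open>m\<close> the height is at least \<open>U\<close>, so the
  slope drops by at least \<open>\<mu> \<kappa>\<^sub>0 U\<^sup>p \<delta> / B\<close>, yet stays positive.
\<close>

lemma strength_bound_rising:
  assumes rising: "\<And>x. r0 \<le> x \<Longrightarrow> x \<le> r0 + 2 * \<delta> \<Longrightarrow> y x > 0"
  shows "\<exists>U>0. \<mu> * U powr p \<le> C\<^sub>1 * U \<and> 1 \<le> C\<^sub>2 * (U + \<mu> * U powr p)"
proof -
  define q m where "q = r0 + \<delta>" and "m = r0 + 2 * \<delta>"
  have qm: "r0 < q" "q < m" "m < r1" "m - q = \<delta>" "q - r0 = \<delta>"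
    using \<delta> by (auto simp: q_def m_def)
  define U where "U = v q"
  have U: "U > 0" unfolding U_def using v_increasing[of r0 q] rising qm v0 by (simp add: m_def)
  have v_ge: "U \<le> v x" if "q \<le> x" "x \<le> m" for x
    unfolding U_def using v_increasing[of q x] rising qm that by (cases "q = x") (force simp: m_def)+
  have "v r0 + (- y q) * r0 \<le> v q + (- y q) * q"
  proof (rule nondecreasing_within[OF has_derivative_add_linear[OF dv]])
    fix x assume "r0 < x" "x < q"
    then show "0 \<le> y x + - y q"
      using slope_nonincreasing[of x q] rising[of q] qm by (simp add: m_def)
  qed (use qm in auto)
  then have yq: "y q * \<delta> \<le> U"
    using v0 qm by (simp add: U_def q_def algebra_simps)
  define E where "E = \<mu> * \<kappa>\<^sub>0 * U powr p / B"
  have "y m + E * m \<le> y q + E * q"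
  proof (rule nonincreasing_within[OF has_derivative_add_linear[OF dy]])
    fix x assume x: "q < x" "x < m"
    then have "E \<le> force \<mu> x (v x) / B"
      unfolding E_def using force_ge[of x U] v_ge[of x] U qm B by (intro divide_right_mono) auto
    moreover have "y x > 0" using rising[of x] x qm by (simp add: m_def)
    moreover have "0 \<le> n * A * y x / x / B" using \<open>y x > 0\<close> n A B x qm r0 by simp
    moreover have "y' x = - (force \<mu> x (v x) / B + n * A * y x / x / B)"
      using y'_nonneg_slope[of x] \<open>y x > 0\<close> x qm by simp
    ultimately show "y' x + E \<le> 0"
      by linarith
  qed (use qm in auto)
  moreover have "y m > 0" using rising[of m] qm by (simp add: m_def)
  ultimately have "E * \<delta> \<le> y q" using qm by (simp add: q_def m_def algebra_simps)
  then have "E * \<delta> * \<delta> \<le> y q * \<delta>" using \<delta> by (intro mult_right_mono) auto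
  with yq have "E * \<delta>\<^sup>2 \<le> U" by (simp add: power2_eq_square)
  then have "\<mu> * U powr p \<le> B / (\<kappa>\<^sub>0 * \<delta>\<^sup>2) * U"
    using B \<kappa>\<^sub>0_pos \<delta> by (simp add: E_def field_simps)
  also have "\<dots> \<le> C\<^sub>1 * U"
  proof (intro mult_right_mono)
    have "1 * B \<le> \<rho>\<^sup>2 * max A B" using \<rho> B by (intro mult_mono) auto
    then show "B / (\<kappa>\<^sub>0 * \<delta>\<^sup>2) \<le> C\<^sub>1"
      unfolding C\<^sub>1_def using \<kappa>\<^sub>0_pos \<delta> by (intro divide_right_mono) auto
  qed (use U in auto)
  finally have 1: "\<mu> * U powr p \<le> C\<^sub>1 * U" .
  have "1 \<le> y q + n * A / (r0 * B) * U + \<mu> * \<kappa>\<^sub>1 * U powr p / B * (q - r0)"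
    by (rule initial_slope_bound) (use qm rising in \<open>auto simp: U_def m_def\<close>)
  also have "\<dots> \<le> C\<^sub>2 * U + C\<^sub>2 * (\<mu> * U powr p)"
  proof -
    have th: "1 \<le> \<theta> powr p" using \<theta> p by (intro ge_one_powr_ge_zero) auto
    have a1: "y q \<le> 1 / \<delta> * U" using yq \<delta> by (simp add: field_simps)
    have a2: "n * A / (r0 * B) \<le> n * A * \<theta> / (r0 * B)"
      using \<theta> n A B r0 by (intro divide_right_mono) auto
    have a3: "\<kappa>\<^sub>1 / B * \<delta> \<le> 4 * \<kappa>\<^sub>1 * \<theta> powr p * \<delta> / B"
      using mult_mono[of 1 "4 * \<theta> powr p" "\<kappa>\<^sub>1 * \<delta> / B" "\<kappa>\<^sub>1 * \<delta> / B"] th \<kappa>\<^sub>1_pos \<delta> B by (simp add: algebra_simps)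
    have nn: "0 \<le> 1 / \<delta>" "0 \<le> n * A * \<theta> / (r0 * B)" "0 \<le> 4 * \<kappa>\<^sub>1 * \<theta> powr p * \<delta> / B"
      using \<theta> n A B r0 \<kappa>\<^sub>1_pos \<delta> by auto
    have "1 / \<delta> + n * A / (r0 * B) \<le> C\<^sub>2" "\<kappa>\<^sub>1 / B * \<delta> \<le> C\<^sub>2"
      unfolding C\<^sub>2_def using a2 a3 nn by linarith+
    then have b1: "(1 / \<delta> + n * A / (r0 * B)) * U \<le> C\<^sub>2 * U"
      and b2: "(\<kappa>\<^sub>1 / B * \<delta>) * (\<mu> * U powr p) \<le> C\<^sub>2 * (\<mu> * U powr p)"
      using U \<mu> by (intro mult_right_mono; simp)+
    show ?thesis using a1 b1 b2 qm by (simp add: algebra_simps)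
  qed
  finally have 2: "1 \<le> C\<^sub>2 * (U + \<mu> * U powr p)" by (simp add: algebra_simps)
  show ?thesis using U 1 2 by blast
qed

text \<open>
  The turning point \<open>c\<close> lies in the first half; take \<open>q = r0 + 3 * \<delta>\<close> and \<open>U = v q\<close>.  Since \<open>r\<^sup>K v'\<close> is
  nonincreasing after \<open>c\<close>, the slope \<open>- Y\<close> at \<open>q\<close> controls, up to the factor \<open>\<rho>\<close>, the slopes between \<open>c\<close> and
  \<open>q\<close> from below and those after \<open>q\<close> from above.  After \<open>q\<close> the trajectory has to stay nonnegative on an interval of length \<open>\<delta>\<close>, so \<open>Y\<close> is at most a multiple of \<open>U\<close>; hence the drop from \<open>c\<close> to \<open>q\<close>
  is at most a multiple of \<open>U\<close> as well, which compares \<open>V = v c\<close> with \<open>U\<close>.  Between \<open>c\<close> and \<open>q\<close> the height is at least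
  \<open>U\<close>, so the forcing makes \<open>Y\<close> at least a multiple of \<open>\<mu> U\<^sup>p\<close>.
\<close>

lemma strength_bound_falling:
  assumes falling: "y (r0 + 2 * \<delta>) \<le> 0" and end_nonneg: "v r1 \<ge> 0"
  shows "\<exists>U>0. \<mu> * U powr p \<le> C\<^sub>1 * U \<and> 1 \<le> C\<^sub>2 * (U + \<mu> * U powr p)"
proof -
  have "r0 \<le> r0 + 2 * \<delta>" "r0 + 2 * \<delta> \<le> r1" using \<delta> by auto
  from this falling obtain c where c: "r0 < c" "c \<le> r0 + 2 * \<delta>" "y c \<le> 0" "\<And>x. r0 \<le> x \<Longrightarrow> x < c \<Longrightarrow> y x > 0"
    "\<And>x. c \<le> x \<Longrightarrow> x \<le> r1 \<Longrightarrow> y x \<le> 0"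
    by (rule turning_point) blast
  define q where "q = r0 + 3 * \<delta>"
  have q: "r0 < q" "c < q" "q < r1" "r1 - q = \<delta>" "q - c \<ge> \<delta>" "q - c \<le> 4 * \<delta>"
    using c \<delta> by (auto simp: q_def)
  define U V Y where "U = v q" and "V = v c" and "Y = - y q"
  have U: "U > 0" unfolding U_def using v_positive[OF end_nonneg] q by simp
  have Y: "Y \<ge> 0" using c q by (simp add: Y_def)
  have K: "K > 0" using n A B by (simp add: K_def)
  have ratio: "(s / t) powr K \<le> \<rho>" if "r0 \<le> s" "s \<le> r1" "r0 \<le> t" "t \<le> r1" for s t
  proof -
    have "s / t \<le> r1 / r0" using that r0 by (intro frac_le) auto
    then show ?thesis unfolding \<rho>_def using K that r0 by (intro powr_mono2) auto
  qed
  have left: "- y s \<le> \<rho> * Y" if s: "c \<le> s" "s \<le> q" for s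
  proof -
    have "W q \<le> W s" by (rule W_nonincreasing[of c]) (use s c q in auto)
    then have "- y s \<le> (q / s) powr K * Y"
      using s c r0 q by (simp add: W_def Y_def powr_divide field_simps)
    also have "\<dots> \<le> \<rho> * Y" using ratio[of q s] Y s c q by (intro mult_right_mono) auto
    finally show ?thesis .
  qed
  have right: "Y / \<rho> \<le> - y s" if s: "q \<le> s" "s \<le> r1" for s
  proof -
    have "W s \<le> W q" by (rule W_nonincreasing[of c]) (use s c q in auto)
    then have "Y \<le> (s / q) powr K * (- y s)"
      using s c r0 q by (simp add: W_def Y_def powr_divide field_simps)
    also have "\<dots> \<le> \<rho> * (- y s)" using ratio[of s q] c(5)[of s] s q by (intro mult_right_mono) auto
    finally show ?thesis using \<rho> by (simp add: field_simps)
  qed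
  have "v c + \<rho> * Y * c \<le> v q + \<rho> * Y * q"
  proof (rule nondecreasing_within[OF has_derivative_add_linear[OF dv]])
    fix x assume "c < x" "x < q"
    then show "0 \<le> y x + \<rho> * Y" using left[of x] by simp
  qed (use c q in auto)
  then have VU: "V \<le> U + \<rho> * Y * (q - c)" by (simp add: U_def V_def algebra_simps)
  have "v r1 + Y / \<rho> * r1 \<le> v q + Y / \<rho> * q"
  proof (rule nonincreasing_within[OF has_derivative_add_linear[OF dv]])
    fix x assume "q < x" "x < r1"
    then show "y x + Y / \<rho> \<le> 0" using right[of x] by simp
  qed (use q in auto)
  moreover have "Y / \<rho> * (r1 - q) = Y / \<rho> * r1 - Y / \<rho> * q" by (rule right_diff_distrib)
  ultimately have "Y / \<rho> * (r1 - q) \<le> U" using end_nonneg by (simp only: U_def)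
  then have YU: "Y * \<delta> \<le> \<rho> * U" using q \<rho> by (simp add: field_simps)
  have "V \<le> U + \<rho> * Y * (4 * \<delta>)"
  proof -
    have "\<rho> * Y * (q - c) \<le> \<rho> * Y * (4 * \<delta>)"
      using q \<rho> Y by (intro mult_left_mono) auto
    then show ?thesis using VU by linarith
  qed
  also have "\<dots> \<le> U + 4 * \<rho> * (\<rho> * U)"
    using mult_left_mono[OF YU, of "4 * \<rho>"] \<rho> by simp
  finally have V\<theta>: "V \<le> \<theta> * U" by (simp add: \<theta>_def algebra_simps power2_eq_square)
  have v_ge: "U \<le> v x" if "c \<le> x" "x \<le> q" for x
    unfolding U_def by (rule nonincreasing_within[OF dv]) (use that c q in auto)
  define E where "E = r0 powr K * (\<mu> * \<kappa>\<^sub>0 * U powr p / max A B)"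
  have M: "max A B > 0" using A by (simp add: less_max_iff_disj)
  have "W q + E * q \<le> W c + E * c"
  proof (rule nonincreasing_within[OF has_derivative_add_linear[OF W_deriv]])
    fix x assume x: "c < x" "x < q"
    then have "\<mu> * \<kappa>\<^sub>0 * U powr p / max A B \<le> force \<mu> x (v x) / max A B"
      using force_ge[of x U] v_ge[of x] U q c M by (intro divide_right_mono) auto
    then have "E \<le> x powr K * (force \<mu> x (v x) / max A B)"
      unfolding E_def using x c r0 K M \<mu> \<kappa>\<^sub>0_pos by (intro mult_mono powr_mono2) auto
    then show "x powr K * (K * y x / x + y' x) + E \<le> 0"
      using W_deriv_le[of x] c(5)[of x] x c q by simp
  qed (use q c in auto)
  moreover have "W c \<le> 0" using c by (simp add: W_def mult_nonneg_nonpos)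
  ultimately have "E * (q - c) \<le> q powr K * Y" by (simp add: W_def Y_def algebra_simps)
  moreover have "E \<ge> 0" unfolding E_def using \<mu> \<kappa>\<^sub>0_pos M by simp
  ultimately have "E * \<delta> \<le> q powr K * Y"
    using mult_left_mono[of \<delta> "q - c" E] q by simp
  then have "\<mu> * \<kappa>\<^sub>0 * U powr p / max A B * \<delta> \<le> (q / r0) powr K * Y"
    using r0 q by (simp add: E_def powr_divide field_simps)
  also have "\<dots> \<le> \<rho> * Y" using ratio[of q r0] q Y by (intro mult_right_mono) auto
  finally have "\<mu> * \<kappa>\<^sub>0 * U powr p / max A B * \<delta> * \<delta> \<le> \<rho> * Y * \<delta>"
    using \<delta> by (intro mult_right_mono) auto
  also have "\<dots> \<le> \<rho> * (\<rho> * U)" using mult_left_mono[OF YU, of \<rho>] \<rho> by (simp add: mult.assoc)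
  finally have 1: "\<mu> * U powr p \<le> C\<^sub>1 * U"
    using M \<kappa>\<^sub>0_pos \<delta> by (simp add: C\<^sub>1_def field_simps power2_eq_square)
  have "1 \<le> y c + n * A / (r0 * B) * (\<theta> * U) + \<mu> * \<kappa>\<^sub>1 * (\<theta> * U) powr p / B * (c - r0)"
    by (rule initial_slope_bound) (use c q V\<theta> in \<open>auto simp: V_def\<close>)
  also have "\<dots> \<le> C\<^sub>2 * U + C\<^sub>2 * (\<mu> * U powr p)"
  proof -
    have nn: "0 \<le> 1 / \<delta>" "0 \<le> n * A * \<theta> / (r0 * B)" "0 \<le> 4 * \<kappa>\<^sub>1 * \<theta> powr p * \<delta> / B"
      using \<theta> n A B r0 \<kappa>\<^sub>1_pos \<delta> by auto
    have le: "n * A * \<theta> / (r0 * B) \<le> C\<^sub>2" "4 * \<kappa>\<^sub>1 * \<theta> powr p * \<delta> / B \<le> C\<^sub>2"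
      unfolding C\<^sub>2_def using nn by linarith+
    have b1: "(n * A * \<theta> / (r0 * B)) * U \<le> C\<^sub>2 * U"
      using le(1) U by (intro mult_right_mono) auto
    have "(\<mu> * \<kappa>\<^sub>1 * (\<theta> * U) powr p / B) * (c - r0) \<le> (\<mu> * \<kappa>\<^sub>1 * (\<theta> * U) powr p / B) * (4 * \<delta>)"
      using q c \<mu> \<kappa>\<^sub>1_pos B \<delta> by (intro mult_left_mono) auto
    also have "\<dots> = (4 * \<kappa>\<^sub>1 * \<theta> powr p * \<delta> / B) * (\<mu> * U powr p)"
      using \<theta> U by (simp add: powr_mult)
    also have "\<dots> \<le> C\<^sub>2 * (\<mu> * U powr p)"
      using le(2) \<mu> by (intro mult_right_mono) auto
    finally show ?thesis using b1 c(3) by simp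
  qed
  finally have 2: "1 \<le> C\<^sub>2 * (U + \<mu> * U powr p)" by (simp add: algebra_simps)
  show ?thesis using U 1 2 by blast
qed

lemma strength_bound:
  assumes "v r1 \<ge> 0"
  shows "\<mu> \<le> C\<^sub>1 * (C\<^sub>2 * (1 + C\<^sub>1)) powr (p - 1)"
proof -
  have "\<exists>U>0. \<mu> * U powr p \<le> C\<^sub>1 * U \<and> 1 \<le> C\<^sub>2 * (U + \<mu> * U powr p)"
  proof (cases "y (r0 + 2 * \<delta>) \<le> 0")
    case True
    then show ?thesis using strength_bound_falling assms by blast
  next
    case False
    then have "y x > 0" if "r0 \<le> x" "x \<le> r0 + 2 * \<delta>" for x
      using slope_stays_nonpos[of x "r0 + 2 * \<delta>"] that \<delta> by force
    then show ?thesis by (rule strength_bound_rising)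
  qed
  then show ?thesis using strength_bound_aux \<mu> by blast
qed

end

section \<open>Existence of the profile\<close>

context shooting begin

lemma trajectory_hitting_zero:
  obtains \<mu> v y where "trajectory A B n a p r0 r1 \<mu> v y" "v r1 = 0" "\<mu> > 0"
proof -
  \<comment> \<open>a strength above the bound of lemma \<open>strength_bound\<close>, so that the trajectory ends below zero\<close>
  define m1 where "m1 = max 0 (C\<^sub>1 * (C\<^sub>2 * (1 + C\<^sub>1)) powr (p - 1)) + 1"
  have m1: "m1 > 0" "m1 > C\<^sub>1 * (C\<^sub>2 * (1 + C\<^sub>1)) powr (p - 1)" by (auto simp: m1_def)
  obtain L where L: "L > 0" "\<And>z x y. z \<in> {0..m1} \<times> {r0..r1} \<Longrightarrow> norm (rhs z x - rhs z y) \<le> L * norm (x - y)"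
    using rhs_lipschitz[of m1] m1 by auto
  obtain \<phi> :: "real \<times> real \<Rightarrow> real \<times> real" where
    cont: "continuous_on ({0..m1} \<times> {r0..r1}) \<phi>"
    and init: "\<And>\<mu>. \<mu> \<in> {0..m1} \<Longrightarrow> \<phi> (\<mu>, r0) = (0, 1)"
    and deriv: "\<And>\<mu> r. \<mu> \<in> {0..m1} \<Longrightarrow> r \<in> {r0..r1} \<Longrightarrow>
      ((\<lambda>r. \<phi> (\<mu>, r)) has_vector_derivative rhs (\<mu>, r) (\<phi> (\<mu>, r))) (at r within {r0..r1})"
    using parametric_picard_on[OF rhs_continuous[of 0 m1] L(2,1) less_imp_le[OF r01]
        less_imp_le[OF m1(1)], where ?x0.0 = "(0, 1)"] by blast
  define v where "v = (\<lambda>\<mu> r. fst (\<phi> (\<mu>, r)))"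
  define y where "y = (\<lambda>\<mu> r. snd (\<phi> (\<mu>, r)))"
  have T: "trajectory A B n a p r0 r1 \<mu> (v \<mu>) (y \<mu>)" if \<mu>: "\<mu> \<in> {0..m1}" for \<mu>
  proof
    fix r assume r: "r \<in> {r0..r1}"
    have "rhs (\<mu>, r) (\<phi> (\<mu>, r)) = (y \<mu> r, pucci_real (1/A) (1/B) (- force \<mu> r (v \<mu> r) - n / r * pucci_real A B (y \<mu> r)))"
      by (simp add: rhs_def v_def y_def split_beta)
    with deriv[OF \<mu> r] have *: "((\<lambda>r. \<phi> (\<mu>, r)) has_vector_derivative
       (y \<mu> r, pucci_real (1/A) (1/B) (- force \<mu> r (v \<mu> r) - n / r * pucci_real A B (y \<mu> r)))) (at r within {r0..r1})"
      by simp
    show "(v \<mu> has_real_derivative y \<mu> r) (at r within {r0..r1})"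
      using bounded_linear.has_vector_derivative[OF bounded_linear_fst *]
      unfolding v_def[abs_def] by (simp add: has_real_derivative_iff_has_vector_derivative)
    show "(y \<mu> has_real_derivative pucci_real (1/A) (1/B) (- force \<mu> r (v \<mu> r) - n / r * pucci_real A B (y \<mu> r)))
       (at r within {r0..r1})"
      using bounded_linear.has_vector_derivative[OF bounded_linear_snd *]
      by (simp add: has_real_derivative_iff_has_vector_derivative y_def)
  qed (use \<mu> init[OF \<mu>] in \<open>auto simp: v_def y_def\<close>)
  have v0: "v 0 r1 > 0"
    using trajectory.v_end_positive_if_unforced[OF T] m1 by simp
  have v1: "v m1 r1 < 0"
    using trajectory.strength_bound[OF T, of m1] m1 by force
  have "continuous_on {0..m1} (\<lambda>\<mu>. v \<mu> r1)"
    unfolding v_def by (intro continuous_on_fst continuous_on_compose2[OF cont] continuous_intros)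
      (use r01 in auto)
  then obtain \<mu> where \<mu>: "0 \<le> \<mu>" "\<mu> \<le> m1" "v \<mu> r1 = 0"
    using IVT2'[of "\<lambda>\<mu>. v \<mu> r1" m1 0 0] v0 v1 m1 by auto
  moreover have "\<mu> \<noteq> 0"
  proof
    assume "\<mu> = 0"
    with \<mu>(3) have "v 0 r1 = 0" by simp
    with v0 show False by simp
  qed
  ultimately show ?thesis
    using T by (intro that[of \<mu> "v \<mu>" "y \<mu>"]) auto
qed

lemma radial_profile:
  obtains v y z where
    "continuous_on {r0..r1} v" "v r0 = 0" "v r1 = 0"
    "\<And>r. r0 < r \<Longrightarrow> r < r1 \<Longrightarrow> v r > 0"
    "\<And>r. r0 < r \<Longrightarrow> r < r1 \<Longrightarrow> (v has_real_derivative y r) (at r)"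
    "\<And>r. r0 < r \<Longrightarrow> r < r1 \<Longrightarrow> (y has_real_derivative z r) (at r)"
    "continuous_on {r0<..<r1} z"
    "\<And>r. r0 < r \<Longrightarrow> r < r1 \<Longrightarrow>
       pucci_real A B (z r) + n * pucci_real A B (y r / r) + r powr a * v r powr p = 0"
proof -
  obtain \<mu> v y where T: "trajectory A B n a p r0 r1 \<mu> v y" and end0: "v r1 = 0" and \<mu>_pos: "\<mu> > 0"
    using trajectory_hitting_zero by blast
  interpret trajectory A B n a p r0 r1 \<mu> v y by (rule T)
  \<comment> \<open>the multiple of \<open>v\<close> that absorbs the strength \<open>\<mu>\<close>: the operator scales with \<open>t\<close>, the power with \<open>t\<^sup>p\<close>\<close>
  define t where "t = \<mu> powr (1 / (p - 1))"
  have t: "t > 0" "t powr p = \<mu> * t"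
  proof -
    show "t > 0" using \<mu>_pos by (simp add: t_def)
    have "t powr (p - 1) = \<mu>" using \<mu>_pos p by (simp add: t_def powr_powr)
    then show "t powr p = \<mu> * t" using \<open>t > 0\<close> powr_add[of t "p - 1" 1] by simp
  qed
  have at_eq: "at r within {r0..r1} = at r" if "r0 < r" "r < r1" for r
    using that by (intro at_within_Icc_at) auto
  have pos: "v r > 0" if "r0 < r" "r < r1" for r
    using v_positive that end0 by simp
  have cv: "continuous_on {r0..r1} v" by (rule DERIV_continuous_on[OF dv])
  have cy: "continuous_on {r0..r1} y" by (rule y_cont) simp
  show ?thesis
  proof (rule that[of "\<lambda>r. t * v r" "\<lambda>r. t * y r" "\<lambda>r. t * y' r"])
    show "continuous_on {r0..r1} (\<lambda>r. t * v r)" by (intro continuous_intros cv)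
    show "((\<lambda>r. t * v r) has_real_derivative t * y r) (at r)" if "r0 < r" "r < r1" for r
      using dv[of r] that at_eq[OF that] by (auto intro!: DERIV_cmult)
    show "((\<lambda>r. t * y r) has_real_derivative t * y' r) (at r)" if "r0 < r" "r < r1" for r
      using dy[of r] that at_eq[OF that] by (auto intro!: DERIV_cmult)
    have "continuous_on {r0<..<r1} (\<lambda>r. t * pucci_real (1/A) (1/B)
        (- (\<mu> * r powr a * (max 0 (min (v r) (r1 - r0))) powr p) - n / r * pucci_real A B (y r)))"
    proof -
      have "continuous_on {r0<..<r1} v" "continuous_on {r0<..<r1} y"
        by (auto intro: continuous_on_subset[OF cv] continuous_on_subset[OF cy])
      moreover have "continuous_on {r0<..<r1} (\<lambda>r. r powr a)"
        using r0 by (intro continuous_on_powr continuous_on_id continuous_on_const) auto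
      moreover have "continuous_on {r0<..<r1} (\<lambda>r. max 0 (min (v r) (r1 - r0)) powr p)"
        using p calculation(1)
        by (intro continuous_on_positive_part_powr continuous_on_min continuous_on_const) auto
      ultimately show ?thesis
        using r0 by (intro continuous_on_pucci_real continuous_on_diff continuous_on_minus
          continuous_on_mult continuous_on_divide continuous_on_id continuous_on_const) auto
    qed
    then show "continuous_on {r0<..<r1} (\<lambda>r. t * y' r)" by (simp add: force_def)
    fix r assume r: "r0 < r" "r < r1"
    show "t * v r > 0" using pos[OF r] t by simp
    have "pucci_real A B (t * y' r) = t * (- force \<mu> r (v r) - n / r * pucci_real A B (y r))"
      using t by (simp add: pucci_real_scale pucci_real_inverse[OF A B])
    moreover have "pucci_real A B (t * y r / r) = t / r * pucci_real A B (y r)"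
      using pucci_real_scale[of "t / r" A B "y r"] t r r0 by simp
    moreover have "force \<mu> r (v r) = \<mu> * r powr a * v r powr p"
      using force_eq[of r] r pos[OF r] by simp
    moreover have "(t * v r) powr p = \<mu> * t * v r powr p"
      using t pos[OF r] by (simp add: powr_mult)
    ultimately show "pucci_real A B (t * y' r) + n * pucci_real A B (t * y r / r) + r powr a * (t * v r) powr p = 0"
      by (simp add: algebra_simps)
  qed (use v0 end0 in auto)
qed

end

section \<open>Radial solutions on the annulus\<close>

lemma radial_solution:
  fixes a p r0 r1 A B :: real and M :: "real^'n^'n \<Rightarrow> real"
  assumes "CARD('n) \<ge> 2" "A > 0" "B > 0" "p > 1" "0 < r0" "r0 < r1"
    and M: "\<And>X. M X = A * (\<Sum>e\<in>#{#e \<in># eigenvalues X. e \<ge> 0#}. e)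
       + B * (\<Sum>e\<in>#{#e \<in># eigenvalues X. e < 0#}. e)"
  shows "\<exists>u. classical_positive_solution M a p (annulus r0 r1) u
           \<and> radial_on (closure (annulus r0 r1)) u"
proof -
  interpret shooting A B "real CARD('n) - 1" a p r0 r1
    by standard (use assms in auto)
  obtain v y z where
    cv: "continuous_on {r0..r1} v" and v0: "v r0 = 0" "v r1 = 0"
    and pos: "\<And>r. r0 < r \<Longrightarrow> r < r1 \<Longrightarrow> v r > 0"
    and dv: "\<And>r. r0 < r \<Longrightarrow> r < r1 \<Longrightarrow> (v has_real_derivative y r) (at r)"
    and dy: "\<And>r. r0 < r \<Longrightarrow> r < r1 \<Longrightarrow> (y has_real_derivative z r) (at r)"
    and cz: "continuous_on {r0<..<r1} z"
    and ode: "\<And>r. r0 < r \<Longrightarrow> r < r1 \<Longrightarrow>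
       pucci_real A B (z r) + (real CARD('n) - 1) * pucci_real A B (y r / r) + r powr a * v r powr p = 0"
    by (rule radial_profile) blast
  define u where "u = (\<lambda>x :: real^'n. v (norm x))"
  let ?S = "annulus r0 r1 :: (real^'n) set"
  have "closed {x :: real^'n. r0 \<le> norm x \<and> norm x \<le> r1}"
    by (intro closed_Collect_conj closed_Collect_le continuous_intros)
  then have cl: "closure ?S \<subseteq> {x. r0 \<le> norm x \<and> norm x \<le> r1}"
    by (intro closure_minimal) (auto simp: annulus_def)
  have "classical_positive_solution M a p ?S u"
    unfolding classical_positive_solution_def
  proof (intro conjI ballI)
    show "C2_on ?S u"
      unfolding u_def by (rule C2_on_radial[OF r0 dv dy cz])
    show "continuous_on (closure ?S) u"
      unfolding u_def by (rule continuous_on_compose2[OF cv]) (use cl in \<open>auto intro!: continuous_intros\<close>)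
    show "u x > 0" if "x \<in> ?S" for x
      using that pos by (simp add: u_def annulus_def)
    show "u x = 0" if "x \<in> frontier ?S" for x
    proof -
      have "x \<in> closure ?S" "x \<notin> ?S"
        using that interior_open[OF open_annulus[of r0 r1]] by (auto simp: frontier_def)
      then have "norm x = r0 \<or> norm x = r1"
        using cl by (force simp: annulus_def)
      then show ?thesis using v0 by (auto simp: u_def)
    qed
    show "M (hessian u x) + norm x powr a * u x powr p = 0" if x: "x \<in> ?S" for x
    proof -
      have nx: "x \<noteq> 0" "r0 < norm x" "norm x < r1" using x r0 by (auto simp: annulus_def)
      have hess: "hessian u x = (\<chi> i j. (if i = j then y (norm x) / norm x else 0)
          + (z (norm x) - y (norm x) / norm x) / (norm x)\<^sup>2 * x $ i * x $ j)"
        unfolding u_def by (rule hessian_radial[OF r0 dv dy cz x])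
      have "M (hessian u x) = pucci_real A B (z (norm x)) + (real CARD('n) - 1) * pucci_real A B (y (norm x) / norm x)"
        unfolding M hess weighted_eigenvalue_sum[OF nx(1)] using nx by simp
      then show ?thesis using ode[OF nx(2,3)] by (simp add: u_def)
    qed
  qed
  moreover have "radial_on (closure ?S) u"
    by (auto simp: radial_on_def u_def)
  ultimately show ?thesis by blast
qed

theorem theorem1p1:
  fixes lam Lam a p \<aa> \<bb> :: real
    and M :: "real^'n^'n \<Rightarrow> real"
  assumes "CARD('n) \<ge> 3"
    and "0 < lam" and "lam \<le> Lam"
    and "a > -1"
    and "(M = pucci_plus lam Lam \<and> lam / Lam * (real CARD('n) - 1) + 1 > 2) \<or> M = pucci_minus lam Lam"
    and "p > 1"
    and "0 < \<aa>" and "\<aa> < \<bb>"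
  shows "\<exists>u. classical_positive_solution M a p (annulus \<aa> \<bb>) u
           \<and> radial_on (closure (annulus \<aa> \<bb>)) u"
proof -
  \<comment> \<open>the weights are \<open>(Lam, lam)\<close> for \<open>pucci_plus\<close> and \<open>(lam, Lam)\<close> for \<open>pucci_minus\<close>\<close>
  have "Lam > 0" using assms(2,3) by simp
  then have "\<exists>A B. A > 0 \<and> B > 0 \<and> (\<forall>X. M X = A * (\<Sum>e\<in>#{#e \<in># eigenvalues X. e \<ge> 0#}. e)
       + B * (\<Sum>e\<in>#{#e \<in># eigenvalues X. e < 0#}. e))"
    using assms(2,5) unfolding pucci_plus_def[abs_def] pucci_minus_def[abs_def] by blast
  then show ?thesis
    using radial_solution[of _ _ p \<aa> \<bb> M a] assms by auto
qed

end
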